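(* Let $\Pi$ be a probability measure on a product $\mathcal X\times\mathcal Y$ of Polish spaces, with marginals $\Pi_X,\Pi_Y$ and conditionals $\Pi_{Y|X}(\cdot|x)$, $\Pi(\cdot|y)=\Pi_{X|Y}(\cdot|y)$. Assume: (1) for each $y\in\mathcal Y$ the kernel $H_{2|y}$ on $\mathcal X$ is $\Pi(\cdot|y)$-reversible and positive, and there is $\beta_2:(0,\infty)\times\mathcal Y\to[0,\infty)$ with $\beta_2(\cdot,y)$ admissible for each $y$ and $\mathrm{Var}_{\Pi(\cdot|y)}(g)\le s\,\mathcal E_{\Pi(\cdot|y)}(H_{2|y},g)+\beta_2(s,y)\|g\|_{\mathrm{osc}}^2$ for all $s>0$, $g\in L^2(\Pi(\cdot|y))$; (2) there is an admissible $\beta_0$ such that the exact Gibbs kernel $P=G_1G_2$ satisfies $\|f\|_\Pi^2\le s\,\mathcal E_\Pi(P^*P,f)+\beta_0(s)\|f\|_{\mathrm{osc}}^2$ for all $s>0$, $f\in L^2_0(\Pi)$. Let $K_0^*$ and $K_2^*$ be associated with $\beta_0(s)$ and $\beta_2(s):=\int_{\mathcal Y}\beta_2(s,y)\,\Pi_Y(dy)$ respectively, and put $K^*(v)=K_2^*\big(\tfrac12K_0^*(v)\big)$, $F(x)=\int_x^{1/4}\frac{dv}{K^*(v)}$ for $x\in(0,1/4]$. Then for $P_2=G_1H_2$, every $f\in L^2_0(\Pi)$ with $0<\|f\|_{\mathrm{osc}}<\infty$, and every integer $n\ge2$, $$\|P_2^nf\|_\Pi^2\le\|f\|_{\mathr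m{osc}}^2\,F^{-1}(n-1).$$
   Context: For a probability measure $\mu$: $L^2_0(\mu)$ is the space of mean-zero functions in $L^2(\mu)$, $\|f\|_\mu^2=\int f^2d\mu$, $\|f\|_{\mathrm{osc}}=\operatorname{ess\,sup}_\mu f-\operatorname{ess\,inf}_\mu f$. A $\mu$-invariant Markov kernel $T$ acts by $(Tf)(x)=\int f(x')T(x,dx')$, $T^*$ is its $L^2(\mu)$-adjoint, and $\mathcal E_\mu(T,f)=\langle (I-T)f,f\rangle_\mu$. A $\mu$-reversible $T$ is positive if $\langle Tf,f\rangle_\mu\ge0$ for all $f\in L^2(\mu)$. Admissible functions: $\beta:(0,\infty)\to[0,\infty)$ decreasing with $\lim_{s\to\infty}\beta(s)=0$ (without loss of generality $\beta\le 1/4$); $\beta_2(s,y)$ is assumed measurable in $y$. The function $K^*$ associated with $\beta$ is $K^*(v)=\sup_{u\ge0}\{uv-K(u)\}$, where $K(u)=u\,\beta(1/u)$ for $u>0$ and $K(0)=0$. Standing convention: $\beta$'s are normalised so that the associated functions satisfy $K^*(v)\le v$ for $v\in[0,1/4]$; then $F$ is a decreasing bijection from $(0,1/4]$ onto $[0,\infty)$. Operators on $L^2(\Pi)$: $G_1f(x,y)=\int f(x,y')\Pi_{Y|X}(dy'|x)$, $G_2f(x,y)=\int f(x',y)\Pi_{X|Y}(dx'|y)$, $H_2f(x,y)=\int f(x',y)H_{2|y}(dx'|x)$, where $(x,y)\mapsto H_{2|y}(\cdot|x)$ is a Markov kernel from $\mathcal X\times\mathcal Y$ to $\mathcal X$.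 *)

theory Defs
  imports "HOL-Probability.Probability"
begin

section \<open>The space $L^2(\mu)$ and the oscillation seminorm\<close>

text \<open>
  Elements of $L^2(\mu)$ are represented by functions rather than by equivalence classes. For
  \<open>\<mu>\<close>-invariant kernels, replacing a function by an almost everywhere equal one changes none of
  the inner products, norms and oscillations below.
\<close>

definition L2 :: "'a measure \<Rightarrow> ('a \<Rightarrow> real) set" where
  "L2 \<mu> = {f \<in> borel_measurable \<mu>. integrable \<mu> (\<lambda>x. (f x)\<^sup>2)}"

definition L2_zero :: "'a measure \<Rightarrow> ('a \<Rightarrow> real) set" where
  "L2_zero \<mu> = {f \<in> L2 \<mu>. (\<integral>x. f x \<partial>\<mu>) = 0}"

definition L2_inner :: "'a measure \<Rightarrow> ('a \<Rightarrow> real) \<Rightarrow> ('a \<Rightarrow> real) \<Rightarrow> real" where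
  "L2_inner \<mu> f g = (\<integral>x. f x * g x \<partial>\<mu>)"

definition L2_norm_sq :: "'a measure \<Rightarrow> ('a \<Rightarrow> real) \<Rightarrow> real" where
  "L2_norm_sq \<mu> f = (\<integral>x. (f x)\<^sup>2 \<partial>\<mu>)"

definition essinf :: "'a measure \<Rightarrow> ('a \<Rightarrow> ereal) \<Rightarrow> ereal" where
  "essinf \<mu> f = - esssup \<mu> (\<lambda>x. - f x)"

text \<open>The value is \<open>\<infinity>\<close> for functions that are not essentially bounded.\<close>

definition osc :: "'a measure \<Rightarrow> ('a \<Rightarrow> real) \<Rightarrow> ereal" where
  "osc \<mu> f = esssup \<mu> (\<lambda>x. ereal (f x)) - essinf \<mu> (\<lambda>x. ereal (f x))"

section \<open>Operators, kernels and Dirichlet forms\<close>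

definition kernel_op :: "('a \<Rightarrow> 'a measure) \<Rightarrow> ('a \<Rightarrow> real) \<Rightarrow> 'a \<Rightarrow> real" where
  "kernel_op T f x = (\<integral>x'. f x' \<partial>T x)"

definition dirichlet :: "'a measure \<Rightarrow> (('a \<Rightarrow> real) \<Rightarrow> 'a \<Rightarrow> real) \<Rightarrow> ('a \<Rightarrow> real) \<Rightarrow> real" where
  "dirichlet \<mu> T f = L2_inner \<mu> (\<lambda>x. f x - T f x) f"

definition reversible :: "'a measure \<Rightarrow> ('a \<Rightarrow> 'a measure) \<Rightarrow> bool" where
  "reversible \<mu> T \<longleftrightarrow> (\<forall>A\<in>sets \<mu>. \<forall>B\<in>sets \<mu>.
     (\<integral>\<^sup>+x\<in>A. emeasure (T x) B \<partial>\<mu>) = (\<integral>\<^sup>+x\<in>B. emeasure (T x) A \<partial>\<mu>))"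

definition positive_kernel :: "'a measure \<Rightarrow> ('a \<Rightarrow> 'a measure) \<Rightarrow> bool" where
  "positive_kernel \<mu> T \<longleftrightarrow> (\<forall>f\<in>L2 \<mu>. 0 \<le> L2_inner \<mu> (kernel_op T f) f)"

definition is_L2_adjoint ::
  "'a measure \<Rightarrow> (('a \<Rightarrow> real) \<Rightarrow> 'a \<Rightarrow> real) \<Rightarrow> (('a \<Rightarrow> real) \<Rightarrow> 'a \<Rightarrow> real) \<Rightarrow> bool" where
  "is_L2_adjoint \<mu> T S \<longleftrightarrow>
     (\<forall>g\<in>L2 \<mu>. S g \<in> L2 \<mu>) \<and> (\<forall>f\<in>L2 \<mu>. \<forall>g\<in>L2 \<mu>. L2_inner \<mu> (T f) g = L2_inner \<mu> f (S g))"

text \<open>For a bounded operator on $L^2(\mu)$ the adjoint is unique up to \<open>\<mu>\<close>-null sets.\<close>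

definition L2_adjoint ::
  "'a measure \<Rightarrow> (('a \<Rightarrow> real) \<Rightarrow> 'a \<Rightarrow> real) \<Rightarrow> ('a \<Rightarrow> real) \<Rightarrow> 'a \<Rightarrow> real" where
  "L2_adjoint \<mu> T = (SOME S. is_L2_adjoint \<mu> T S)"

section \<open>Gibbs kernels on a product space\<close>

text \<open>\<open>\<kappa>\<close> is a version of the regular conditional distribution of \<open>V\<close> given \<open>U\<close> under \<open>M\<close>.\<close>

definition is_cond_distr ::
  "'c measure \<Rightarrow> ('c \<Rightarrow> 'u::topological_space) \<Rightarrow> ('c \<Rightarrow> 'v::topological_space) \<Rightarrow>
   ('u \<Rightarrow> 'v measure) \<Rightarrow> bool" where
  "is_cond_distr M U V \<kappa> \<longleftrightarrow>
     \<kappa> \<in> borel \<rightarrow>\<^sub>M prob_algebra borel \<and>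
     (\<forall>A\<in>sets borel. \<forall>B\<in>sets borel.
        emeasure M (U -` A \<inter> V -` B \<inter> space M) =
          (\<integral>\<^sup>+u\<in>A. emeasure (\<kappa> u) B \<partial>distr M borel U))"

definition op_G1 :: "('a \<Rightarrow> 'b measure) \<Rightarrow> ('a \<times> 'b \<Rightarrow> real) \<Rightarrow> 'a \<times> 'b \<Rightarrow> real" where
  "op_G1 \<kappa>YX f = (\<lambda>(x, y). \<integral>y'. f (x, y') \<partial>\<kappa>YX x)"

definition op_G2 :: "('b \<Rightarrow> 'a measure) \<Rightarrow> ('a \<times> 'b \<Rightarrow> real) \<Rightarrow> 'a \<times> 'b \<Rightarrow> real" where
  "op_G2 \<kappa>XY f = (\<lambda>(x, y). \<integral>x'. f (x', y) \<partial>\<kappa>XY y)"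

definition op_H2 :: "('b \<Rightarrow> 'a \<Rightarrow> 'a measure) \<Rightarrow> ('a \<times> 'b \<Rightarrow> real) \<Rightarrow> 'a \<times> 'b \<Rightarrow> real" where
  "op_H2 H f = (\<lambda>(x, y). \<integral>x'. f (x', y) \<partial>H y x)"

section \<open>Admissible functions and rates\<close>

text \<open>
  Functions on $(0,\infty)$ are total functions of which only the values at positive arguments
  matter. ``Decreasing'' is meant in the weak sense. The bound $1/4$ loses no generality, since
  the variance of \<open>f\<close> is at most a quarter of its squared oscillation.
\<close>

definition admissible :: "(real \<Rightarrow> real) \<Rightarrow> bool" where
  "admissible \<beta> \<longleftrightarrow>
     (\<forall>s>0. 0 \<le> \<beta> s \<and> \<beta> s \<le> 1/4) \<and> antimono_on {0<..} \<beta> \<and> (\<beta> \<longlongrightarrow> 0) at_top"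

definition K_fun :: "(real \<Rightarrow> real) \<Rightarrow> real \<Rightarrow> real" where
  "K_fun \<beta> u = (if u = 0 then 0 else u * \<beta> (1 / u))"

definition K_star :: "(real \<Rightarrow> real) \<Rightarrow> real \<Rightarrow> ereal" where
  "K_star \<beta> v = (SUP u\<in>{0..}. ereal (u * v - K_fun \<beta> u))"

definition normalised :: "(real \<Rightarrow> real) \<Rightarrow> bool" where
  "normalised \<beta> \<longleftrightarrow> (\<forall>v\<in>{0..1/4}. K_star \<beta> v \<le> ereal v)"

text \<open>
  For normalised \<open>\<beta>0\<close> and \<open>\<beta>2\<close> both values of \<^const>\<open>K_star\<close> below are finite when
  $0 \le v \le 1/4$, so nothing is lost by passing to real numbers.
\<close>

definition K_star_comp :: "(real \<Rightarrow> real) \<Rightarrow> (real \<Rightarrow> real) \<Rightarrow> real \<Rightarrow> real" where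
  "K_star_comp \<beta>2 \<beta>0 v = real_of_ereal (K_star \<beta>2 (1/2 * real_of_ereal (K_star \<beta>0 v)))"

definition F_fun :: "(real \<Rightarrow> real) \<Rightarrow> real \<Rightarrow> real" where
  "F_fun k x = integral {x..1/4} (\<lambda>v. 1 / k v)"

definition F_inv :: "(real \<Rightarrow> real) \<Rightarrow> real \<Rightarrow> real" where
  "F_inv k = the_inv_into {0<..1/4} (F_fun k)"

end

theory Submission
  imports Defs
begin

text \<open>
  Let \<open>h = P2^i f\<close> with \<open>i \<ge> 1\<close> and \<open>v = \<parallel>h\<parallel>\<^sup>2 / D\<close>, where \<open>D\<close> is the squared oscillation of \<open>f\<close>. The
  function \<open>h\<close> is fixed by the projection \<open>G1\<close>, has mean zero, and oscillates no more than \<open>f\<close>.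
  The weak Poincare inequality of the exact sampler bounds \<open>K0*(v) / 2\<close> by the mean conditional
  variance \<open>(\<parallel>h\<parallel>\<^sup>2 - \<parallel>G2 h\<parallel>\<^sup>2) / D\<close>, and the integrated weak Poincare inequalities of the kernels
  \<open>H2 y\<close> turn this into \<open>K*(v) \<le> (\<parallel>h\<parallel>\<^sup>2 - \<langle>H2 h, h\<rangle>) / D\<close>. Since \<open>H2\<close> is positive,
  \<open>\<parallel>G1 H2 h\<parallel>\<^sup>2 \<le> \<parallel>H2 h\<parallel>\<^sup>2 \<le> \<langle>H2 h, h\<rangle>\<close>. Hence \<open>K*(v)\<close> is at most the decrement of \<open>v\<close> in one step,
  and \<open>F(v)\<close> increases by at least \<open>1\<close> along each step.
\<close>

section \<open>Measures on products\<close>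

text \<open>Rectangles form an intersection-stable generator of the product sigma-algebra. Since
  \<open>J\<close> is finite, the whole space alone serves as the exhausting sequence.\<close>

lemma measure_eqI_rectangles:
  assumes sets: "sets J = sets (M \<Otimes>\<^sub>M N)" "sets J' = sets (M \<Otimes>\<^sub>M N)"
    and "finite_measure J"
    and eq: "\<And>A B. A \<in> sets M \<Longrightarrow> B \<in> sets N \<Longrightarrow> emeasure J (A \<times> B) = emeasure J' (A \<times> B)"
  shows "J = J'"
proof (rule measure_eqI_generator_eq[OF Int_stable_pair_measure_generator, where \<Omega>="space M \<times> space N"
      and A="\<lambda>_. space M \<times> space N"])
  show "{a \<times> b |a b. a \<in> sets M \<and> b \<in> sets N} \<subseteq> Pow (space M \<times> space N)"
    by (auto dest: sets.sets_into_space)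
  show "sets J = sigma_sets (space M \<times> space N) {a \<times> b |a b. a \<in> sets M \<and> b \<in> sets N}"
    "sets J' = sigma_sets (space M \<times> space N) {a \<times> b |a b. a \<in> sets M \<and> b \<in> sets N}"
    using sets by (simp_all add: sets_pair_measure)
  show "emeasure J (space M \<times> space N) \<noteq> \<infinity>" for i :: nat
    using \<open>finite_measure J\<close> by (simp add: finite_measure.emeasure_finite)
qed (use eq in auto)

text \<open>The bound measure is the law of \<open>e u v\<close> with \<open>u\<close> drawn from
  \<open>N\<close> and \<open>v\<close> from \<open>\<kappa> u\<close>. Leaving \<open>e\<close>
  free covers both the ordered pair and the flipped pair.\<close>

lemma nn_integral_bind_distr:
  assumes \<kappa>: "\<kappa> \<in> N \<rightarrow>\<^sub>M prob_algebra K"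
    and e: "(\<lambda>(u, v). e u v) \<in> N \<Otimes>\<^sub>M K \<rightarrow>\<^sub>M L" and f: "f \<in> borel_measurable L"
  shows "(\<integral>\<^sup>+z. f z \<partial>bind N (\<lambda>u. distr (\<kappa> u) L (e u))) = (\<integral>\<^sup>+u. \<integral>\<^sup>+v. f (e u v) \<partial>\<kappa> u \<partial>N)"
proof -
  have "(\<lambda>u. distr (\<kappa> u) L (e u)) \<in> N \<rightarrow>\<^sub>M subprob_algebra L"
    by (intro measurable_distr2[OF e] measurable_prob_algebraD[OF \<kappa>])
  then have "(\<integral>\<^sup>+z. f z \<partial>bind N (\<lambda>u. distr (\<kappa> u) L (e u))) = (\<integral>\<^sup>+u. \<integral>\<^sup>+z. f z \<partial>distr (\<kappa> u) L (e u) \<partial>N)"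
    by (rule nn_integral_bind[OF f])
  also have "\<dots> = (\<integral>\<^sup>+u. \<integral>\<^sup>+v. f (e u v) \<partial>\<kappa> u \<partial>N)"
  proof (rule nn_integral_cong)
    fix u assume u: "u \<in> space N"
    then have "sets (\<kappa> u) = sets K"
      using measurable_space[OF \<kappa>] by (auto simp: space_prob_algebra)
    then have "e u \<in> \<kappa> u \<rightarrow>\<^sub>M L"
      using measurable_Pair2[OF e u] by (simp cong: measurable_cong_sets)
    then show "(\<integral>\<^sup>+z. f z \<partial>distr (\<kappa> u) L (e u)) = (\<integral>\<^sup>+v. f (e u v) \<partial>\<kappa> u)"
      by (rule nn_integral_distr) (simp add: f)
  qed
  finally show ?thesis .
qed

lemma prob_space_bind_distr:
  assumes "prob_space N" and \<kappa>: "\<kappa> \<in> N \<rightarrow>\<^sub>M prob_algebra K"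
    and e: "(\<lambda>(u, v). e u v) \<in> N \<Otimes>\<^sub>M K \<rightarrow>\<^sub>M L"
  shows "prob_space (bind N (\<lambda>u. distr (\<kappa> u) L (e u)))"
    and "sets (bind N (\<lambda>u. distr (\<kappa> u) L (e u))) = sets L"
proof -
  interpret prob_space N by fact
  have k: "(\<lambda>u. distr (\<kappa> u) L (e u)) \<in> N \<rightarrow>\<^sub>M prob_algebra L"
    by (rule measurable_distr_prob_space2[OF \<kappa> e])
  then show "prob_space (bind N (\<lambda>u. distr (\<kappa> u) L (e u)))"
    using measurable_space[OF k] by (intro prob_space_bind[where S=L] measurable_prob_algebraD AE_I2)
      (auto simp: space_prob_algebra)
  show "sets (bind N (\<lambda>u. distr (\<kappa> u) L (e u))) = sets L"
    by (rule sets_bind) (use measurable_space[OF k] not_empty in \<open>auto simp: space_prob_algebra\<close>)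
qed

lemma prob_algebra_cong: "sets M = sets N \<Longrightarrow> prob_algebra M = prob_algebra N"
  unfolding prob_algebra_def by (simp cong: subprob_algebra_cong)

lemma (in prob_space) bounded_integrable:
  fixes f :: "'a \<Rightarrow> real"
  assumes "f \<in> borel_measurable M" "\<And>x. \<bar>f x\<bar> \<le> B"
  shows "integrable M f"
  using assms by (intro integrable_const_bound[where B=B]) auto

lemma (in prob_space) integral_between:
  fixes f :: "'a \<Rightarrow> real"
  assumes [measurable]: "f \<in> borel_measurable M" and f: "\<And>x. f x \<in> {a..b}"
  shows "(\<integral>x. f x \<partial>M) \<in> {a..b}"
proof -
  have "\<bar>f x\<bar> \<le> max \<bar>a\<bar> \<bar>b\<bar>" for x
    using f[of x] by auto
  then have "integrable M f"
    by (intro bounded_integrable) auto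
  then show ?thesis
    using f by (auto intro!: integral_ge_const integral_le_const)
qed

section \<open>Square integrable functions\<close>

lemma L2_measurable [measurable_dest]: "f \<in> L2 \<mu> \<Longrightarrow> f \<in> borel_measurable \<mu>"
  by (simp add: L2_def)

lemma L2_integrable_mult:
  assumes "f \<in> L2 \<mu>" "g \<in> L2 \<mu>"
  shows "integrable \<mu> (\<lambda>x. f x * g x)"
proof (rule Bochner_Integration.integrable_bound)
  show "integrable \<mu> (\<lambda>x. (f x)\<^sup>2 + (g x)\<^sup>2)"
    using assms by (auto simp: L2_def)
  show "(\<lambda>x. f x * g x) \<in> borel_measurable \<mu>"
    using assms by measurable
  have "\<bar>a * b\<bar> \<le> a\<^sup>2 + b\<^sup>2" for a b :: real
  proof -
    have "2 * \<bar>a * b\<bar> \<le> a\<^sup>2 + b\<^sup>2"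
      using sum_squares_bound[of "\<bar>a\<bar>" "\<bar>b\<bar>"] by (simp add: abs_mult)
    then show ?thesis by linarith
  qed
  then show "AE x in \<mu>. norm (f x * g x) \<le> norm ((f x)\<^sup>2 + (g x)\<^sup>2)"
    by (auto intro!: AE_I2)
qed

lemma L2_dominated:
  assumes "f \<in> L2 \<mu>" "g \<in> borel_measurable \<mu>" "AE x in \<mu>. \<bar>g x\<bar> \<le> \<bar>f x\<bar>"
  shows "g \<in> L2 \<mu>"
  unfolding L2_def
proof (intro CollectI conjI)
  show "integrable \<mu> (\<lambda>x. (g x)\<^sup>2)"
  proof (rule Bochner_Integration.integrable_bound)
    show "integrable \<mu> (\<lambda>x. (f x)\<^sup>2)"
      using assms by (auto simp: L2_def)
    show "AE x in \<mu>. norm ((g x)\<^sup>2) \<le> norm ((f x)\<^sup>2)"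
      using assms(3) by eventually_elim (simp add: abs_le_square_iff)
  qed (use assms in measurable)
qed fact

lemma L2_diff:
  assumes "f \<in> L2 \<mu>" "g \<in> L2 \<mu>"
  shows "(\<lambda>x. f x - g x) \<in> L2 \<mu>"
  unfolding L2_def
proof (intro CollectI conjI)
  have "integrable \<mu> (\<lambda>x. (f x)\<^sup>2 - 2 * (f x * g x) + (g x)\<^sup>2)"
    using assms L2_integrable_mult[OF assms] by (auto simp: L2_def)
  then show "integrable \<mu> (\<lambda>x. (f x - g x)\<^sup>2)"
    by (simp add: power2_diff algebra_simps)
qed (use assms in measurable)

lemma (in finite_measure) L2_bounded:
  assumes "f \<in> borel_measurable M" "\<And>x. x \<in> space M \<Longrightarrow> \<bar>f x\<bar> \<le> B"
  shows "f \<in> L2 M"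
proof (rule L2_dominated)
  show "(\<lambda>_. B) \<in> L2 M"
    by (simp add: L2_def)
  show "AE x in M. \<bar>f x\<bar> \<le> \<bar>B\<bar>"
    using assms(2) by (intro AE_I2) fastforce
qed fact

lemma L2_norm_sq_inner: "L2_norm_sq \<mu> f = L2_inner \<mu> f f"
  by (simp add: L2_norm_sq_def L2_inner_def power2_eq_square)

lemma L2_norm_sq_nonneg [simp]: "0 \<le> L2_norm_sq \<mu> f"
  by (simp add: L2_norm_sq_def)

lemma L2_inner_commute: "L2_inner \<mu> f g = L2_inner \<mu> g f"
  by (simp add: L2_inner_def mult.commute)

lemma L2_inner_diff_left:
  assumes "f \<in> L2 \<mu>" "g \<in> L2 \<mu>" "h \<in> L2 \<mu>"
  shows "L2_inner \<mu> (\<lambda>x. f x - g x) h = L2_inner \<mu> f h - L2_inner \<mu> g h"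
  using L2_integrable_mult[OF assms(1,3)] L2_integrable_mult[OF assms(2,3)]
  by (simp add: L2_inner_def left_diff_distrib)

lemma L2_inner_diff_right:
  assumes "f \<in> L2 \<mu>" "g \<in> L2 \<mu>" "h \<in> L2 \<mu>"
  shows "L2_inner \<mu> h (\<lambda>x. f x - g x) = L2_inner \<mu> h f - L2_inner \<mu> h g"
  using L2_inner_diff_left[OF assms] by (simp add: L2_inner_commute)

text \<open>Expand the square of the norm of \<open>f - g\<close>. For a contraction
  \<open>T\<close> this bounds \<open>L2_inner\<close> of \<open>T f\<close> and \<open>f\<close> by
  the squared norm of \<open>f\<close>, without Cauchy-Schwarz.\<close>

lemma L2_inner_le:
  assumes "f \<in> L2 \<mu>" "g \<in> L2 \<mu>"
  shows "2 * L2_inner \<mu> f g \<le> L2_norm_sq \<mu> f + L2_norm_sq \<mu> g"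
proof -
  have "0 \<le> L2_norm_sq \<mu> (\<lambda>x. f x - g x)"
    by simp
  also have "\<dots> = L2_norm_sq \<mu> f + L2_norm_sq \<mu> g - 2 * L2_inner \<mu> f g"
    using assms L2_diff[OF assms]
    by (simp add: L2_norm_sq_inner L2_inner_diff_left L2_inner_diff_right L2_inner_commute[of _ g f])
  finally show ?thesis by simp
qed

lemma dirichlet_eq:
  assumes "f \<in> L2 \<mu>" "T f \<in> L2 \<mu>"
  shows "dirichlet \<mu> T f = L2_norm_sq \<mu> f - L2_inner \<mu> (T f) f"
  using assms by (simp add: dirichlet_def L2_inner_diff_left L2_norm_sq_inner)

lemma L2_inner_cong_AE:
  assumes "AE x in \<mu>. f x = f' x" "f \<in> borel_measurable \<mu>" "f' \<in> borel_measurable \<mu>" "g \<in> borel_measurable \<mu>"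
  shows "L2_inner \<mu> f g = L2_inner \<mu> f' g"
  unfolding L2_inner_def by (rule integral_cong_AE) (use assms in auto)

section \<open>Reversible kernels\<close>

text \<open>Only detailed balance on sets is assumed; invariance, contraction and self-adjointness
  are derived. The locale serves the global kernels on the product space as well as the kernels on
  single fibres.\<close>

locale reversible_kernel = prob_space M for M :: "'a measure" +
  fixes T :: "'a \<Rightarrow> 'a measure"
  assumes kernel: "T \<in> M \<rightarrow>\<^sub>M prob_algebra M"
    and reversible: "reversible M T"
begin

lemma kernel_subprob [measurable]: "T \<in> M \<rightarrow>\<^sub>M subprob_algebra M"
  by (rule measurable_prob_algebraD[OF kernel])

lemma prob_space_kernel: "x \<in> space M \<Longrightarrow> prob_space (T x)"
  and sets_kernel: "x \<in> space M \<Longrightarrow> sets (T x) = sets M"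
  using measurable_space[OF kernel] by (auto simp: space_prob_algebra)

lemma space_kernel: "x \<in> space M \<Longrightarrow> space (T x) = space M"
  using sets_kernel by (rule sets_eq_imp_space_eq)

lemma measurable_kernel: "f \<in> borel_measurable M \<Longrightarrow> x \<in> space M \<Longrightarrow> f \<in> borel_measurable (T x)"
  using sets_kernel by (simp cong: measurable_cong_sets)

lemma kernel_op_measurable [measurable]:
  "f \<in> borel_measurable M \<Longrightarrow> kernel_op T f \<in> borel_measurable M"
  unfolding kernel_op_def
  by (rule measurable_compose[OF kernel_subprob integral_measurable_subprob_algebra])

text \<open>Detailed balance says that the joint law of a start \<open>x\<close> and its successor
  \<open>y\<close> agrees on rectangles with its flip. The two laws are therefore equal, and both
  sides integrate the same function against them.\<close>

lemma nn_integral_kernel_symmetric: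
  assumes u [measurable]: "u \<in> borel_measurable M" and v [measurable]: "v \<in> borel_measurable M"
  shows "(\<integral>\<^sup>+x. u x * (\<integral>\<^sup>+y. v y \<partial>T x) \<partial>M) = (\<integral>\<^sup>+x. v x * (\<integral>\<^sup>+y. u y \<partial>T x) \<partial>M)"
proof -
  \<comment> \<open>\<open>J Pair\<close> is the joint law of start and successor, and
    \<open>J\<close> at the flipped pairing is the same law with the coordinates exchanged.\<close>
  define J where "J e = bind M (\<lambda>x. distr (T x) (M \<Otimes>\<^sub>M M) (e x))" for e :: "'a \<Rightarrow> 'a \<Rightarrow> 'a \<times> 'a"
  have meas: "(\<lambda>(x, y). Pair x y) \<in> M \<Otimes>\<^sub>M M \<rightarrow>\<^sub>M M \<Otimes>\<^sub>M M"
    "(\<lambda>(x, y). (\<lambda>x y. (y, x)) x y) \<in> M \<Otimes>\<^sub>M M \<rightarrow>\<^sub>M M \<Otimes>\<^sub>M M"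
    by measurable
  have prob: "prob_space (J Pair)" "prob_space (J (\<lambda>x y. (y, x)))"
    and sets: "sets (J Pair) = sets (M \<Otimes>\<^sub>M M)" "sets (J (\<lambda>x y. (y, x))) = sets (M \<Otimes>\<^sub>M M)"
    using prob_space_bind_distr[OF prob_space_axioms kernel meas(1)] 
      prob_space_bind_distr[OF prob_space_axioms kernel meas(2)] by (auto simp: J_def)
  have int: "(\<integral>\<^sup>+z. f z \<partial>J Pair) = (\<integral>\<^sup>+x. \<integral>\<^sup>+y. f (x, y) \<partial>T x \<partial>M)"
    "(\<integral>\<^sup>+z. f z \<partial>J (\<lambda>x y. (y, x))) = (\<integral>\<^sup>+x. \<integral>\<^sup>+y. f (y, x) \<partial>T x \<partial>M)"
    if "f \<in> borel_measurable (M \<Otimes>\<^sub>M M)" for f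
    unfolding J_def using nn_integral_bind_distr[OF kernel meas(1) that]
       nn_integral_bind_distr[OF kernel meas(2) that] by auto
  have "J Pair = J (\<lambda>x y. (y, x))"
  proof (rule measure_eqI_rectangles[OF sets])
    show "finite_measure (J Pair)"
      using prob(1) by (rule prob_space.finite_measure)
    fix A B assume [measurable]: "A \<in> sets M" "B \<in> sets M"
    have em: "emeasure J' (A \<times> B) = (\<integral>\<^sup>+z. indicator A (fst z) * indicator B (snd z) \<partial>J')"
      if "sets J' = sets (M \<Otimes>\<^sub>M M)" for J'
    proof -
      have "emeasure J' (A \<times> B) = (\<integral>\<^sup>+z. indicator (A \<times> B) z \<partial>J')"
        using that by simp
      also have "\<dots> = (\<integral>\<^sup>+z. indicator A (fst z) * indicator B (snd z) \<partial>J')"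
        by (intro nn_integral_cong) (auto simp: indicator_def)
      finally show ?thesis .
    qed
    have "emeasure (J Pair) (A \<times> B) = (\<integral>\<^sup>+x. \<integral>\<^sup>+y. indicator A x * indicator B y \<partial>T x \<partial>M)"
      using em[OF sets(1)] by (simp add: int)
    also have "\<dots> = (\<integral>\<^sup>+x\<in>A. emeasure (T x) B \<partial>M)"
      by (intro nn_integral_cong) (simp add: nn_integral_cmult measurable_kernel sets_kernel mult.commute)
    also have "\<dots> = (\<integral>\<^sup>+x\<in>B. emeasure (T x) A \<partial>M)"
      using reversible by (simp add: reversible_def)
    also have "\<dots> = (\<integral>\<^sup>+x. \<integral>\<^sup>+y. indicator A y * indicator B x \<partial>T x \<partial>M)"
      by (intro nn_integral_cong) (simp add: nn_integral_multc measurable_kernel sets_kernel)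
    also have "\<dots> = emeasure (J (\<lambda>x y. (y, x))) (A \<times> B)"
      using em[OF sets(2)] by (simp add: int)
    finally show "emeasure (J Pair) (A \<times> B) = emeasure (J (\<lambda>x y. (y, x))) (A \<times> B)" .
  qed
  moreover have "(\<integral>\<^sup>+x. u x * (\<integral>\<^sup>+y. v y \<partial>T x) \<partial>M) = (\<integral>\<^sup>+z. u (fst z) * v (snd z) \<partial>J Pair)"
    by (subst int) (auto intro!: nn_integral_cong simp: nn_integral_cmult measurable_kernel)
  moreover have "(\<integral>\<^sup>+x. v x * (\<integral>\<^sup>+y. u y \<partial>T x) \<partial>M) = (\<integral>\<^sup>+z. u (fst z) * v (snd z) \<partial>J (\<lambda>x y. (y, x)))"
    by (subst int) (auto intro!: nn_integral_cong simp: nn_integral_multc measurable_kernel mult.commute)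
  ultimately show ?thesis
    by simp
qed

text \<open>Invariance of \<open>M\<close>: the symmetry above with one of the two functions equal
  to \<open>1\<close>.\<close>

lemma nn_integral_kernel:
  assumes [measurable]: "v \<in> borel_measurable M"
  shows "(\<integral>\<^sup>+x. \<integral>\<^sup>+y. v y \<partial>T x \<partial>M) = (\<integral>\<^sup>+x. v x \<partial>M)"
proof -
  have "(\<integral>\<^sup>+x. \<integral>\<^sup>+y. v y \<partial>T x \<partial>M) = (\<integral>\<^sup>+x. v x * (\<integral>\<^sup>+y. 1 \<partial>T x) \<partial>M)"
    using nn_integral_kernel_symmetric[of "\<lambda>_. 1" v] by simp
  also have "\<dots> = (\<integral>\<^sup>+x. v x \<partial>M)"
    by (intro nn_integral_cong) (simp add: prob_space.emeasure_space_1[OF prob_space_kernel])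
  finally show ?thesis .
qed

text \<open>By invariance the mean of \<open>emeasure (T x) N\<close> is the measure of
  \<open>N\<close>, so a null set is charged from almost no start. This is why almost everywhere
  equal functions have almost everywhere equal images.\<close>

lemma AE_kernel:
  assumes "AE x in M. P x"
  shows "AE x in M. AE y in T x. P y"
proof -
  obtain N where N: "{x \<in> space M. \<not> P x} \<subseteq> N" "N \<in> null_sets M"
    using assms by (auto simp: eventually_ae_filter)
  then have [measurable]: "N \<in> sets M" by auto
  have "(\<integral>\<^sup>+x. emeasure (T x) N \<partial>M) = (\<integral>\<^sup>+x. \<integral>\<^sup>+y. indicator N y \<partial>T x \<partial>M)"
    by (intro nn_integral_cong) (simp add: sets_kernel)
  also have "\<dots> = 0"
    using N by (subst nn_integral_kernel) auto
  finally have "AE x in M. emeasure (T x) N = 0"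
    by (subst (asm) nn_integral_0_iff_AE) auto
  then show ?thesis
    using AE_space
  proof eventually_elim
    case (elim x)
    then show ?case
      using N by (intro AE_I'[of N]) (auto simp: null_sets_def sets_kernel space_kernel)
  qed
qed

lemma kernel_op_cong_AE:
  assumes "AE x in M. f x = g x" "f \<in> borel_measurable M" "g \<in> borel_measurable M"
  shows "AE x in M. kernel_op T f x = kernel_op T g x"
  using AE_kernel[OF assms(1)] AE_space
proof eventually_elim
  case (elim x)
  then show ?case
    unfolding kernel_op_def by (intro integral_cong_AE) (auto intro: measurable_kernel assms)
qed

lemma AE_integrable_kernel:
  assumes "integrable M (f :: 'a \<Rightarrow> real)"
  shows "AE x in M. integrable (T x) f"
proof -
  have [measurable]: "f \<in> borel_measurable M" using assms by auto
  have "(\<integral>\<^sup>+x. \<integral>\<^sup>+y. norm (f y) \<partial>T x \<partial>M) = (\<integral>\<^sup>+x. norm (f x) \<partial>M)"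
    by (rule nn_integral_kernel) measurable
  also have "\<dots> \<noteq> \<infinity>"
    using assms by (simp add: integrable_iff_bounded)
  finally have "AE x in M. (\<integral>\<^sup>+y. norm (f y) \<partial>T x) \<noteq> \<infinity>"
    by (intro nn_integral_noteq_infinite) auto
  then show ?thesis
    using AE_space
  proof eventually_elim
    case (elim x)
    then show ?case
      by (auto simp: integrable_iff_bounded top.not_eq_extremum intro!: measurable_kernel)
  qed
qed

text \<open>Jensen's inequality for squares, obtained from nonnegativity of the variance under
  \<open>T x\<close>, and then invariance.\<close>

lemma kernel_op_L2:
  assumes f: "f \<in> L2 M"
  shows "kernel_op T f \<in> L2 M" and "L2_norm_sq M (kernel_op T f) \<le> L2_norm_sq M f"
proof -
  have [measurable]: "f \<in> borel_measurable M" and f2: "integrable M (\<lambda>x. (f x)\<^sup>2)"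
    using f by (auto simp: L2_def)
  have "AE x in M. ennreal ((kernel_op T f x)\<^sup>2) \<le> (\<integral>\<^sup>+y. (f y)\<^sup>2 \<partial>T x)"
    using AE_space AE_integrable_kernel[OF f2]
  proof eventually_elim
    case (elim x)
    note x = elim(1) and i = elim(2)
    interpret T: prob_space "T x" by (rule prob_space_kernel[OF x])
    have "integrable (T x) f"
      by (rule T.square_integrable_imp_integrable[OF measurable_kernel[OF _ x] i]) measurable
    then have "(kernel_op T f x)\<^sup>2 \<le> (\<integral>y. (f y)\<^sup>2 \<partial>T x)"
      using T.variance_eq[OF _ i] T.variance_positive[of f] unfolding kernel_op_def by linarith
    then show ?case
      by (subst nn_integral_eq_integral[OF i]) (simp_all add: ennreal_leI)
  qed
  then have "(\<integral>\<^sup>+x. (kernel_op T f x)\<^sup>2 \<partial>M) \<le> (\<integral>\<^sup>+x. \<integral>\<^sup>+y. (f y)\<^sup>2 \<partial>T x \<partial>M)"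
    by (rule nn_integral_mono_AE)
  also have "\<dots> = (\<integral>\<^sup>+x. (f x)\<^sup>2 \<partial>M)"
    by (rule nn_integral_kernel) measurable
  finally have le: "(\<integral>\<^sup>+x. (kernel_op T f x)\<^sup>2 \<partial>M) \<le> (\<integral>\<^sup>+x. (f x)\<^sup>2 \<partial>M)" .
  then have "integrable M (\<lambda>x. (kernel_op T f x)\<^sup>2)"
    using f2 unfolding integrable_iff_bounded by auto
  then show "kernel_op T f \<in> L2 M"
    by (simp add: L2_def)
  show "L2_norm_sq M (kernel_op T f) \<le> L2_norm_sq M f"
    unfolding L2_norm_sq_def
    using le f2 by (subst (1 2) integral_eq_nn_integral) (auto simp: integrable_iff_bounded intro!: enn2real_mono)
qed

text \<open>Linearity can fail at starts where \<open>f\<close> or \<open>g\<close> is not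
  integrable under \<open>T x\<close>, since the integral then defaults to zero; such starts form a
  null set.\<close>

lemma kernel_op_diff_AE:
  assumes "f \<in> L2 M" "g \<in> L2 M"
  shows "AE x in M. kernel_op T (\<lambda>x. f x - g x) x = kernel_op T f x - kernel_op T g x"
proof -
  have "integrable M f" "integrable M g"
    using assms by (auto simp: L2_def intro: square_integrable_imp_integrable)
  from this[THEN AE_integrable_kernel] show ?thesis
    by eventually_elim (simp add: kernel_op_def)
qed

text \<open>For nonnegative functions both pairings are extended nonnegative integrals, where the
  symmetry of the joint law applies without integrability conditions.\<close>

lemma kernel_op_selfadjoint_nonneg:
  assumes fL: "f \<in> L2 M" and gL: "g \<in> L2 M" and f0: "\<And>x. 0 \<le> f x" and g0: "\<And>x. 0 \<le> g x"
  shows "L2_inner M (kernel_op T f) g = L2_inner M f (kernel_op T g)"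
proof -
  have inner: "L2_inner M (kernel_op T p) q = enn2real (\<integral>\<^sup>+x. ennreal (q x) * (\<integral>\<^sup>+y. ennreal (p y) \<partial>T x) \<partial>M)"
    if p: "p \<in> L2 M" and q: "q \<in> L2 M" and p0: "\<And>x. 0 \<le> p x" and q0: "\<And>x. 0 \<le> q x" for p q
  proof -
    have [measurable]: "p \<in> borel_measurable M" "q \<in> borel_measurable M"
      using p q by (auto simp: L2_def)
    have Tp0: "0 \<le> kernel_op T p x" for x
      using p0 by (simp add: kernel_op_def)
    have "integrable M p"
      using p by (auto simp: L2_def intro: square_integrable_imp_integrable)
    from AE_integrable_kernel[OF this]
    have "AE x in M. ennreal (kernel_op T p x * q x) = ennreal (q x) * (\<integral>\<^sup>+y. ennreal (p y) \<partial>T x)"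
    proof eventually_elim
      case (elim x)
      then show ?case
        using p0 q0 Tp0 by (subst nn_integral_eq_integral)
          (auto simp: kernel_op_def[symmetric] ennreal_mult mult.commute)
    qed
    then have "(\<integral>\<^sup>+x. ennreal (kernel_op T p x * q x) \<partial>M)
        = (\<integral>\<^sup>+x. ennreal (q x) * (\<integral>\<^sup>+y. ennreal (p y) \<partial>T x) \<partial>M)"
      by (rule nn_integral_cong_AE)
    moreover have "L2_inner M (kernel_op T p) q = enn2real (\<integral>\<^sup>+x. ennreal (kernel_op T p x * q x) \<partial>M)"
      unfolding L2_inner_def
      by (rule integral_eq_nn_integral) (auto simp: q0 Tp0)
    ultimately show ?thesis
      by simp
  qed
  have [measurable]: "f \<in> borel_measurable M" "g \<in> borel_measurable M"
    using fL gL by (auto simp: L2_def)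
  have "L2_inner M (kernel_op T f) g = L2_inner M (kernel_op T g) f"
    unfolding inner[OF fL gL f0 g0] inner[OF gL fL g0 f0]
    by (subst nn_integral_kernel_symmetric) auto
  then show ?thesis
    by (simp add: L2_inner_commute)
qed

lemma kernel_op_selfadjoint:
  assumes f: "f \<in> L2 M" and g: "g \<in> L2 M"
  shows "L2_inner M (kernel_op T f) g = L2_inner M f (kernel_op T g)"
proof -
  define p :: "('a \<Rightarrow> real) \<Rightarrow> 'a \<Rightarrow> real" where "p = (\<lambda>h x. max 0 (h x))"
  define q :: "('a \<Rightarrow> real) \<Rightarrow> 'a \<Rightarrow> real" where "q = (\<lambda>h x. max 0 (- h x))"
  have nn: "0 \<le> p h x" "0 \<le> q h x" for h x
    by (simp_all add: p_def q_def)
  have L: "p h \<in> L2 M" "q h \<in> L2 M" if h: "h \<in> L2 M" for h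
  proof -
    have [measurable]: "h \<in> borel_measurable M"
      using h by (simp add: L2_def)
    show "p h \<in> L2 M" "q h \<in> L2 M"
      by (auto intro!: L2_dominated[OF h] simp: p_def q_def)
  qed
  have dec: "h = (\<lambda>x. p h x - q h x)" for h
    by (auto simp: p_def q_def fun_eq_iff)
  have T: "L2_inner M (kernel_op T h) k = L2_inner M (kernel_op T (p h)) k - L2_inner M (kernel_op T (q h)) k"
    if h: "h \<in> L2 M" and k: "k \<in> L2 M" for h k
  proof -
    have "AE x in M. kernel_op T h x = kernel_op T (p h) x - kernel_op T (q h) x"
      using kernel_op_diff_AE[OF L[OF h]] by (simp add: dec[of h, symmetric])
    then have "L2_inner M (kernel_op T h) k = L2_inner M (\<lambda>x. kernel_op T (p h) x - kernel_op T (q h) x) k"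
      using h k L[OF h] by (intro L2_inner_cong_AE) (auto simp: L2_def)
    also have "\<dots> = L2_inner M (kernel_op T (p h)) k - L2_inner M (kernel_op T (q h)) k"
      by (intro L2_inner_diff_left kernel_op_L2 L h k)
    finally show ?thesis .
  qed
  have R: "L2_inner M k h = L2_inner M k (p h) - L2_inner M k (q h)"
    if h: "h \<in> L2 M" and k: "k \<in> L2 M" for h k
    using L2_inner_diff_right[OF L[OF h] k] by (simp add: dec[of h, symmetric])
  have S: "L2_inner M (kernel_op T h) k = L2_inner M (kernel_op T k) h"
    if "h \<in> L2 M" "k \<in> L2 M" "\<And>x. 0 \<le> h x" "\<And>x. 0 \<le> k x" for h k
    using kernel_op_selfadjoint_nonneg[OF that] by (simp add: L2_inner_commute)
  note LL = L[OF f] L[OF g]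
  \<comment> \<open>Both sides expand into four pairings of positive and negative parts, which
    \<open>S\<close> matches one by one.\<close>
  have "L2_inner M (kernel_op T f) g = L2_inner M (kernel_op T g) f"
    unfolding T[OF f g] T[OF g f] R[OF f kernel_op_L2(1)[OF LL(3)]] R[OF f kernel_op_L2(1)[OF LL(4)]]
      R[OF g kernel_op_L2(1)[OF LL(1)]] R[OF g kernel_op_L2(1)[OF LL(2)]]
    using S[OF LL(1,3) nn(1) nn(1)] S[OF LL(1,4) nn(1) nn(2)] S[OF LL(2,3) nn(2) nn(1)]
      S[OF LL(2,4) nn(2) nn(2)] by simp
  then show ?thesis
    by (simp add: L2_inner_commute)
qed

text \<open>Test positivity on \<open>f - T f\<close>; this is \<open>T\<^sup>2 \<le> T\<close> for a positive self-adjoint contraction.\<close>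

lemma L2_norm_sq_kernel_le_inner:
  assumes pos: "positive_kernel M T" and f: "f \<in> L2 M"
  shows "L2_norm_sq M (kernel_op T f) \<le> L2_inner M (kernel_op T f) f"
proof -
  define g where "g = kernel_op T f"
  define h where "h = (\<lambda>x. f x - g x)"
  have g: "g \<in> L2 M"
    unfolding g_def by (rule kernel_op_L2(1)[OF f])
  have h: "h \<in> L2 M"
    unfolding h_def by (rule L2_diff[OF f g])
  have Tg: "kernel_op T g \<in> L2 M"
    by (rule kernel_op_L2(1)[OF g])
  have fTg: "L2_inner M f (kernel_op T g) = L2_norm_sq M g"
    using kernel_op_selfadjoint[OF f g] by (simp add: g_def L2_norm_sq_inner)
  have "0 \<le> L2_inner M (kernel_op T h) h"
    using pos h by (simp add: positive_kernel_def)
  also have "\<dots> = L2_inner M (kernel_op T h) f - L2_inner M (kernel_op T h) g"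
    unfolding h_def[symmetric] using L2_inner_diff_right[OF f g kernel_op_L2(1)[OF h]] by (simp add: h_def)
  also have "\<dots> = L2_inner M h g - L2_inner M h (kernel_op T g)"
    using kernel_op_selfadjoint[OF h f] kernel_op_selfadjoint[OF h g] by (simp add: g_def)
  also have "\<dots> = L2_inner M g f - 2 * L2_norm_sq M g + L2_inner M g (kernel_op T g)"
    unfolding h_def L2_inner_diff_left[OF f g g] L2_inner_diff_left[OF f g Tg] fTg
    by (simp add: L2_inner_commute L2_norm_sq_inner)
  also have "L2_inner M g (kernel_op T g) \<le> L2_norm_sq M g"
    using L2_inner_le[OF g Tg] kernel_op_L2(2)[OF g] by simp
  finally show ?thesis
    by (simp add: g_def)
qed

lemma kernel_op_between:
  assumes "f \<in> borel_measurable M" "\<And>x. f x \<in> {a..b}" "x \<in> space M"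
  shows "kernel_op T f x \<in> {a..b}"
  unfolding kernel_op_def
  by (rule prob_space.integral_between[OF prob_space_kernel]) (use assms measurable_kernel in auto)

text \<open>Self-adjointness against the constant \<open>1\<close>, which the kernel
  preserves.\<close>

lemma integral_kernel_op:
  assumes "f \<in> L2 M"
  shows "(\<integral>x. kernel_op T f x \<partial>M) = (\<integral>x. f x \<partial>M)"
proof -
  have "(\<lambda>_. 1) \<in> L2 M"
    by (rule L2_bounded[where B=1]) auto
  then have "(\<integral>x. kernel_op T f x \<partial>M) = (\<integral>x. f x * kernel_op T (\<lambda>_. 1) x \<partial>M)"
    using kernel_op_selfadjoint[OF assms, of "\<lambda>_. 1"] by (simp add: L2_inner_def)
  also have "\<dots> = (\<integral>x. f x \<partial>M)"
    by (intro Bochner_Integration.integral_cong)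
       (simp_all add: kernel_op_def prob_space.prob_space[OF prob_space_kernel])
  finally show ?thesis .
qed

end

text \<open>Sampling afresh from \<mu> gives a joint law that is a product of equal factors, hence
  symmetric. On each fibre this is the reversibility of an exact conditional update.\<close>

lemma reversible_const: "reversible \<mu> (\<lambda>_. \<mu>)"
proof -
  have "(\<integral>\<^sup>+x\<in>A. emeasure \<mu> B \<partial>\<mu>) = emeasure \<mu> B * emeasure \<mu> A" if "A \<in> sets \<mu>" for A B
    using that by (rule nn_integral_cmult_indicator)
  then show ?thesis
    by (simp add: reversible_def mult.commute)
qed

section \<open>Disintegration along a coordinate\<close>

text \<open>
  \<open>e\<close> recombines the two coordinates \<open>U\<close> and \<open>V\<close>, so that the conditionals of \<open>Y\<close> given \<open>X\<close>
  and of \<open>X\<close> given \<open>Y\<close> are both instances.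
\<close>

locale disintegration = prob_space M for M :: "'z::topological_space measure" +
  fixes U :: "'z \<Rightarrow> 'u::polish_space" and V :: "'z \<Rightarrow> 'v::polish_space"
    and e :: "'u \<times> 'v \<Rightarrow> 'z" and \<kappa> :: "'u \<Rightarrow> 'v measure"
  assumes sets_M [measurable_cong]: "sets M = sets borel"
    and U_measurable [measurable]: "U \<in> borel_measurable borel"
    and V_measurable [measurable]: "V \<in> borel_measurable borel"
    and e_measurable [measurable]: "e \<in> borel_measurable borel"
    and e_UV [simp]: "e (U z, V z) = z" and U_e [simp]: "U (e (u, v)) = u" and V_e [simp]: "V (e (u, v)) = v"
    and cond: "is_cond_distr M U V \<kappa>"
begin

definition N :: "'u measure" where "N = distr M borel U"

lemma sets_N [measurable_cong]: "sets N = sets borel"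
  by (simp add: N_def)

lemma prob_space_N: "prob_space N"
  unfolding N_def by (rule prob_space_distr) measurable

lemma kappa_kernel: "\<kappa> \<in> borel \<rightarrow>\<^sub>M prob_algebra borel"
  using cond by (simp add: is_cond_distr_def)

lemma kappa_subprob [measurable]: "\<kappa> \<in> borel \<rightarrow>\<^sub>M subprob_algebra borel"
  by (rule measurable_prob_algebraD[OF kappa_kernel])

lemma prob_space_kappa: "prob_space (\<kappa> u)"
  and sets_kappa [measurable_cong, simp]: "sets (\<kappa> u) = sets borel"
  using measurable_space[OF kappa_kernel, of u] by (auto simp: space_prob_algebra)

text \<open>A conditional distribution is prescribed on rectangles only. They determine the joint
  law of \<open>U\<close> and \<open>V\<close>, and \<open>e\<close> carries that law back to
  \<open>M\<close>.\<close>

lemma nn_integral_disintegration: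
  assumes f [measurable]: "f \<in> borel_measurable borel"
  shows "(\<integral>\<^sup>+z. f z \<partial>M) = (\<integral>\<^sup>+u. \<integral>\<^sup>+v. f (e (u, v)) \<partial>\<kappa> u \<partial>N)"
proof -
  let ?P = "borel \<Otimes>\<^sub>M borel :: ('u \<times> 'v) measure"
  define J where "J = bind N (\<lambda>u. distr (\<kappa> u) ?P (Pair u))"
  have \<kappa>: "\<kappa> \<in> N \<rightarrow>\<^sub>M prob_algebra borel"
    using kappa_kernel by (simp cong: measurable_cong_sets add: sets_N)
  have meas: "(\<lambda>(u, v). Pair u v) \<in> N \<Otimes>\<^sub>M borel \<rightarrow>\<^sub>M ?P"
    by measurable
  have J_sets: "sets J = sets ?P" and J_prob: "prob_space J"
    unfolding J_def using prob_space_bind_distr[OF prob_space_N \<kappa> meas] by auto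
  have J_int: "(\<integral>\<^sup>+z. g z \<partial>J) = (\<integral>\<^sup>+u. \<integral>\<^sup>+v. g (u, v) \<partial>\<kappa> u \<partial>N)" if "g \<in> borel_measurable ?P" for g
    unfolding J_def by (rule nn_integral_bind_distr[OF \<kappa> meas that])
  have "J = distr M ?P (\<lambda>z. (U z, V z))"
  proof (rule measure_eqI_rectangles[OF J_sets])
    show "finite_measure J"
      using J_prob by (rule prob_space.finite_measure)
    fix A :: "'u set" and B :: "'v set" assume [measurable]: "A \<in> sets borel" "B \<in> sets borel"
    have "emeasure J (A \<times> B) = (\<integral>\<^sup>+z. indicator (A \<times> B) z \<partial>J)"
      using J_sets by simp
    also have "\<dots> = (\<integral>\<^sup>+u. \<integral>\<^sup>+v. indicator A u * indicator B v \<partial>\<kappa> u \<partial>N)"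
      by (subst J_int) (auto intro!: nn_integral_cong simp: indicator_def)
    also have "\<dots> = (\<integral>\<^sup>+u\<in>A. emeasure (\<kappa> u) B \<partial>N)"
      by (intro nn_integral_cong) (simp add: nn_integral_cmult mult.commute)
    also have "\<dots> = emeasure M (U -` A \<inter> V -` B \<inter> space M)"
      using cond by (simp add: is_cond_distr_def N_def)
    also have "\<dots> = emeasure (distr M ?P (\<lambda>z. (U z, V z))) (A \<times> B)"
      by (subst emeasure_distr) (auto intro!: arg_cong[where f="emeasure M"])
    finally show "emeasure J (A \<times> B) = emeasure (distr M ?P (\<lambda>z. (U z, V z))) (A \<times> B)" .
  qed simp
  \<comment> \<open>Polish spaces are second countable, so the product sigma-algebra is the Borel
    one and \<open>f\<close> composed with \<open>e\<close> is measurable for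
    \<open>J\<close>.\<close>
  then have "(\<integral>\<^sup>+z. f z \<partial>M) = (\<integral>\<^sup>+z. f (e z) \<partial>J)"
    by (simp add: nn_integral_distr borel_prod)
  also have "\<dots> = (\<integral>\<^sup>+u. \<integral>\<^sup>+v. f (e (u, v)) \<partial>\<kappa> u \<partial>N)"
    by (rule J_int) (simp add: borel_prod)
  finally show ?thesis .
qed

text \<open>The conditional law read as a transition kernel that forgets the current
  \<open>v\<close>; this makes the exact updates special cases of
  \<open>fibre_kernel\<close>.\<close>

lemma kernel_kappa: "(\<lambda>(u :: 'u, v :: 'v). \<kappa> u) \<in> borel \<rightarrow>\<^sub>M prob_algebra borel"
  unfolding case_prod_unfold
  by (rule measurable_compose[OF borel_measurable_continuous_onI kappa_kernel]) (intro continuous_intros)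

lemma fibre_integral_measurable:
  fixes f :: "'z \<Rightarrow> real"
  assumes f [measurable]: "f \<in> borel_measurable borel"
  shows "(\<lambda>u. \<integral>v. f (e (u, v)) \<partial>\<kappa> u) \<in> borel_measurable borel"
proof -
  have "(\<lambda>u. distr (\<kappa> u) borel (\<lambda>v. e (u, v))) \<in> borel \<rightarrow>\<^sub>M subprob_algebra borel"
    by (rule measurable_distr2[OF _ kappa_subprob]) measurable
  then have "(\<lambda>u. \<integral>z. f z \<partial>distr (\<kappa> u) borel (\<lambda>v. e (u, v))) \<in> borel_measurable borel"
    by (rule measurable_compose[OF _ integral_measurable_subprob_algebra]) (rule f)
  then show ?thesis
    by (simp add: integral_distr)
qed

lemma integral_disintegration:
  fixes f :: "'z \<Rightarrow> real"
  assumes f [measurable]: "f \<in> borel_measurable borel" and B: "\<And>z. \<bar>f z\<bar> \<le> B"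
  shows "(\<integral>z. f z \<partial>M) = (\<integral>u. \<integral>v. f (e (u, v)) \<partial>\<kappa> u \<partial>N)"
proof -
  interpret N: prob_space N by (rule prob_space_N)
  interpret \<kappa>: prob_space "\<kappa> u" for u by (rule prob_space_kappa)
  \<comment> \<open>Shifting by \<open>B\<close> makes the integrand nonnegative, which reduces the
    claim to the extended-real disintegration; the shift is removed at the end.\<close>
  let ?g = "\<lambda>z. f z + B"
  let ?h = "\<lambda>u. \<integral>v. ?g (e (u, v)) \<partial>\<kappa> u"
  have g: "?g z \<in> {0..2 * B}" for z
    using B[of z] by auto
  have gB: "\<bar>?g z\<bar> \<le> 2 * B" for z
    using g[of z] by auto
  have ig: "integrable M ?g" "integrable (\<kappa> u) (\<lambda>v. ?g (e (u, v)))" 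
     "integrable M f" "integrable (\<kappa> u) (\<lambda>v. f (e (u, v)))" for u
    by (rule bounded_integrable[OF _ gB] \<kappa>.bounded_integrable[OF _ gB]
        bounded_integrable[OF _ B] \<kappa>.bounded_integrable[OF _ B]; measurable)+
  have hm [measurable]: "?h \<in> borel_measurable N"
    using fibre_integral_measurable[of ?g] by measurable
  have h: "?h u \<in> {0..2 * B}" for u
    by (rule \<kappa>.integral_between[OF _ g]) measurable
  have ih: "integrable N ?h"
    by (rule N.bounded_integrable[where B="2 * B"]) (use h in \<open>auto simp: abs_le_iff\<close>)
  have "ennreal (\<integral>z. ?g z \<partial>M) = (\<integral>\<^sup>+z. ?g z \<partial>M)"
    using ig(1) g by (intro nn_integral_eq_integral[symmetric]) auto
  also have "\<dots> = (\<integral>\<^sup>+u. \<integral>\<^sup>+v. ?g (e (u, v)) \<partial>\<kappa> u \<partial>N)"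
    by (rule nn_integral_disintegration) measurable
  also have "\<dots> = (\<integral>\<^sup>+u. ?h u \<partial>N)"
    using ig(2) g by (intro nn_integral_cong nn_integral_eq_integral) auto
  also have "\<dots> = ennreal (\<integral>u. ?h u \<partial>N)"
    using ih h by (intro nn_integral_eq_integral) auto
  finally have "(\<integral>z. ?g z \<partial>M) = (\<integral>u. ?h u \<partial>N)"
    by (subst (asm) ennreal_inj) (use g h in \<open>auto intro!: integral_nonneg_AE\<close>)
  moreover have "(\<integral>z. ?g z \<partial>M) = (\<integral>z. f z \<partial>M) + B"
    using ig by (simp add: prob_space)
  moreover have "?h u = (\<integral>v. f (e (u, v)) \<partial>\<kappa> u) + B" for u
    using ig by (simp add: \<kappa>.prob_space)
  moreover have "integrable N (\<lambda>u. (\<integral>v. f (e (u, v)) \<partial>\<kappa> u) + B - B)"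
    using ih unfolding calculation(3) by (intro Bochner_Integration.integrable_diff) auto
  ultimately show ?thesis
    by (simp add: N.prob_space)
qed

lemma L2_inner_fibres:
  assumes [measurable]: "f \<in> borel_measurable borel" "g \<in> borel_measurable borel"
    and f: "\<And>z. \<bar>f z\<bar> \<le> B" and g: "\<And>z. \<bar>g z\<bar> \<le> B"
  shows "L2_inner M f g = (\<integral>u. L2_inner (\<kappa> u) (\<lambda>v. f (e (u, v))) (\<lambda>v. g (e (u, v))) \<partial>N)"
    and "integrable N (\<lambda>u. L2_inner (\<kappa> u) (\<lambda>v. f (e (u, v))) (\<lambda>v. g (e (u, v))))"
proof -
  interpret N: prob_space N by (rule prob_space_N)
  have fg: "\<bar>f z * g z\<bar> \<le> B * B" for z
    unfolding abs_mult using f[of z] g[of z] by (intro mult_mono) auto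
  show "L2_inner M f g = (\<integral>u. L2_inner (\<kappa> u) (\<lambda>v. f (e (u, v))) (\<lambda>v. g (e (u, v))) \<partial>N)"
    unfolding L2_inner_def using fg by (intro integral_disintegration[where B="B * B"]) auto
  have "(\<integral>v. f (e (u, v)) * g (e (u, v)) \<partial>\<kappa> u) \<in> {- (B * B)..B * B}" for u
    by (rule prob_space.integral_between[OF prob_space_kappa])
       (use fg[THEN abs_le_D1] fg[THEN abs_le_D2] in \<open>auto simp: minus_le_iff\<close>)
  then show "integrable N (\<lambda>u. L2_inner (\<kappa> u) (\<lambda>v. f (e (u, v))) (\<lambda>v. g (e (u, v))))"
    unfolding L2_inner_def using fibre_integral_measurable[of "\<lambda>z. f z * g z"]
    by (intro N.bounded_integrable[where B="B * B"]) (auto simp: abs_le_iff minus_le_iff)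
qed

text \<open>One update of the coordinate \<open>V\<close> with \<open>U\<close> frozen, written as a
  kernel on the whole space. The two exact updates and the approximate one all become reversible
  kernels of this shape.\<close>

definition fibre_kernel :: "('u \<Rightarrow> 'v \<Rightarrow> 'v measure) \<Rightarrow> 'z \<Rightarrow> 'z measure" where
  "fibre_kernel H z = distr (H (U z) (V z)) borel (\<lambda>v. e (U z, v))"

context
  fixes H :: "'u \<Rightarrow> 'v \<Rightarrow> 'v measure"
  assumes H: "(\<lambda>(u, v). H u v) \<in> borel \<rightarrow>\<^sub>M prob_algebra borel"
begin

lemma sets_H [measurable_cong, simp]: "sets (H u v) = sets borel"
  using measurable_space[OF H, of "(u, v)"] by (auto simp: space_prob_algebra)

lemma kernel_op_fibre_kernel:
  assumes "f \<in> borel_measurable borel"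
  shows "kernel_op (fibre_kernel H) f = (\<lambda>z. \<integral>v. f (e (U z, v)) \<partial>H (U z) (V z))"
  unfolding kernel_op_def fibre_kernel_def using assms by (auto simp: fun_eq_iff integral_distr)

lemma kernel_op_fibre_kernel_e:
  assumes "f \<in> borel_measurable borel"
  shows "kernel_op (fibre_kernel H) f (e (u, v)) = kernel_op (H u) (\<lambda>v. f (e (u, v))) v"
  using assms by (simp add: kernel_op_fibre_kernel) (simp add: kernel_op_def)

lemma H_kernel: "H u \<in> borel \<rightarrow>\<^sub>M prob_algebra borel"
  using measurable_compose[OF _ H, of "Pair u"] by simp

context
  assumes rev: "\<And>u. reversible (\<kappa> u) (H u)"
begin

lemma reversible_kernel_fibre: "reversible_kernel (\<kappa> u) (H u)"
proof -
  have "H u \<in> \<kappa> u \<rightarrow>\<^sub>M prob_algebra (\<kappa> u)"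
    using H_kernel by (simp cong: measurable_cong_sets add: prob_algebra_cong[OF sets_kappa])
  then show ?thesis
    using rev prob_space_kappa by (simp add: reversible_kernel_def reversible_kernel_axioms_def)
qed

text \<open>An update never leaves its fibre. Disintegrating both sides of detailed balance over
  \<open>U\<close> thus leaves, for each \<open>u\<close>, detailed balance of \<open>H u\<close>
  between the slices of \<open>A\<close> and \<open>B\<close>.\<close>

lemma reversible_fibre_kernel: "reversible_kernel M (fibre_kernel H)"
proof
  have "fibre_kernel H \<in> borel \<rightarrow>\<^sub>M prob_algebra borel"
    unfolding fibre_kernel_def
  proof (rule measurable_distr_prob_space2)
    show "(\<lambda>z. H (U z) (V z)) \<in> borel \<rightarrow>\<^sub>M prob_algebra borel"
      using measurable_compose[OF _ H, of "\<lambda>z. (U z, V z)"] by simp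
    show "(\<lambda>(z, v). e (U z, v)) \<in> borel \<Otimes>\<^sub>M borel \<rightarrow>\<^sub>M borel"
      by measurable
  qed
  then show "fibre_kernel H \<in> M \<rightarrow>\<^sub>M prob_algebra M"
    by (simp add: prob_algebra_cong[OF sets_M] cong: measurable_cong_sets)
  show "reversible M (fibre_kernel H)"
    unfolding reversible_def
  proof (intro ballI)
    have *: "(\<integral>\<^sup>+z\<in>A. emeasure (fibre_kernel H z) B \<partial>M) =
        (\<integral>\<^sup>+u. (\<integral>\<^sup>+v\<in>(\<lambda>v. e (u, v)) -` A. emeasure (H u v) ((\<lambda>v. e (u, v)) -` B) \<partial>\<kappa> u) \<partial>N)"
      if [measurable]: "A \<in> sets M" "B \<in> sets M" for A B
    proof -
      have em: "emeasure (fibre_kernel H z) B = emeasure (H (U z) (V z)) ((\<lambda>v. e (U z, v)) -` B)" for z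
        unfolding fibre_kernel_def using that(2)
        by (subst emeasure_distr) (auto simp: sets_eq_imp_space_eq[OF sets_H] sets_M)
      have "(\<lambda>z. emeasure (fibre_kernel H z) B) \<in> borel_measurable M"
        using \<open>fibre_kernel H \<in> M \<rightarrow>\<^sub>M prob_algebra M\<close>
        by (intro measurable_compose[OF measurable_prob_algebraD measurable_emeasure_subprob_algebra]) auto
      then have "(\<lambda>z. emeasure (fibre_kernel H z) B * indicator A z) \<in> borel_measurable M"
        by (rule borel_measurable_times_ennreal) simp
      then have "(\<lambda>z. emeasure (fibre_kernel H z) B * indicator A z) \<in> borel_measurable borel"
        by (simp add: sets_M cong: measurable_cong_sets)
      from nn_integral_disintegration[OF this]
      have "(\<integral>\<^sup>+z\<in>A. emeasure (fibre_kernel H z) B \<partial>M)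
         = (\<integral>\<^sup>+u. \<integral>\<^sup>+v. emeasure (fibre_kernel H (e (u, v))) B * indicator A (e (u, v)) \<partial>\<kappa> u \<partial>N)" .
      then show ?thesis
        by (simp add: em indicator_vimage[abs_def] indicator_def)
    qed
    fix A B assume [measurable]: "A \<in> sets M" "B \<in> sets M"
    show "(\<integral>\<^sup>+z\<in>A. emeasure (fibre_kernel H z) B \<partial>M) = (\<integral>\<^sup>+z\<in>B. emeasure (fibre_kernel H z) A \<partial>M)"
      unfolding *[OF \<open>A \<in> sets M\<close> \<open>B \<in> sets M\<close>] *[OF \<open>B \<in> sets M\<close> \<open>A \<in> sets M\<close>]
    proof (rule nn_integral_cong)
      fix u
      have "(\<lambda>v. e (u, v)) -` A' \<in> sets (\<kappa> u)" if "A' \<in> sets M" for A'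
        using measurable_sets[of "\<lambda>v. e (u, v)" borel borel A'] that by (simp add: sets_M)
      then show "(\<integral>\<^sup>+v\<in>(\<lambda>v. e (u, v)) -` A. emeasure (H u v) ((\<lambda>v. e (u, v)) -` B) \<partial>\<kappa> u) =
          (\<integral>\<^sup>+v\<in>(\<lambda>v. e (u, v)) -` B. emeasure (H u v) ((\<lambda>v. e (u, v)) -` A) \<partial>\<kappa> u)"
        using rev[of u] \<open>A \<in> sets M\<close> \<open>B \<in> sets M\<close> by (simp add: reversible_def)
    qed
  qed
qed

end

end

end

section \<open>The rate functions\<close>

text \<open>The choice \<open>u = 0\<close> in the supremum gives the lower bound and normalisation
  the upper one. The value is thus finite and survives \<open>real_of_ereal\<close>.\<close>

lemma normalised_K_star:
  assumes "normalised \<beta>" "v \<in> {0..1/4}"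
  shows "ereal (real_of_ereal (K_star \<beta> v)) = K_star \<beta> v"
    and "0 \<le> real_of_ereal (K_star \<beta> v)" and "real_of_ereal (K_star \<beta> v) \<le> v"
proof -
  have le: "K_star \<beta> v \<le> ereal v"
    using assms by (simp add: normalised_def)
  have "ereal (0 * v - K_fun \<beta> 0) \<le> K_star \<beta> v"
    unfolding K_star_def by (rule SUP_upper) simp
  then have ge: "0 \<le> K_star \<beta> v"
    by (simp add: K_fun_def zero_ereal_def)
  show "ereal (real_of_ereal (K_star \<beta> v)) = K_star \<beta> v"
    using le ge by (intro ereal_real') auto
  show "0 \<le> real_of_ereal (K_star \<beta> v)"
    using ge by (rule real_of_ereal_pos)
  show "real_of_ereal (K_star \<beta> v) \<le> v"
    using le ge by (cases "K_star \<beta> v") auto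
qed

lemma K_star_upper:
  assumes "normalised \<beta>" "v \<in> {0..1/4}" "0 \<le> u"
  shows "u * v - K_fun \<beta> u \<le> real_of_ereal (K_star \<beta> v)"
proof -
  have "ereal (u * v - K_fun \<beta> u) \<le> K_star \<beta> v"
    unfolding K_star_def by (rule SUP_upper) (simp add: assms)
  then show ?thesis
    using normalised_K_star(1)[OF assms(1,2)] by (metis ereal_less_eq(3))
qed

lemma K_star_mono:
  assumes "normalised \<beta>" "0 \<le> v" "v \<le> w" "w \<le> 1/4"
  shows "real_of_ereal (K_star \<beta> v) \<le> real_of_ereal (K_star \<beta> w)"
proof -
  have "K_star \<beta> v \<le> K_star \<beta> w"
    unfolding K_star_def using assms by (intro SUP_subset_mono order_refl) (auto intro!: mult_left_mono)
  then show ?thesis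
    using assms normalised_K_star(1)[of \<beta> v] normalised_K_star(1)[of \<beta> w]
    by (metis atLeastAtMost_iff ereal_less_eq(3) order_trans)
qed

text \<open>The substitution \<open>s = 1 / u\<close> turns a weak Poincare inequality for all
  \<open>s\<close> into a bound on every term of the Legendre transform. This eliminates the free
  parameter \<open>s\<close>.\<close>

lemma K_star_le:
  assumes "normalised \<beta>" "v \<in> {0..1/4}" "0 \<le> c" "\<And>s. 0 < s \<Longrightarrow> v \<le> s * c + \<beta> s"
  shows "real_of_ereal (K_star \<beta> v) \<le> c"
proof -
  have "K_star \<beta> v \<le> ereal c"
    unfolding K_star_def
  proof (rule SUP_least)
    fix u :: real assume "u \<in> {0..}"
    show "ereal (u * v - K_fun \<beta> u) \<le> ereal c"
    proof (cases "u = 0")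
      case False
      with \<open>u \<in> {0..}\<close> have "0 < u" by simp
      then have "u * v \<le> u * ((1 / u) * c + \<beta> (1 / u))"
        using assms(4)[of "1 / u"] by (intro mult_left_mono) auto
      with \<open>0 < u\<close> show ?thesis
        by (simp add: K_fun_def algebra_simps)
    qed (simp add: K_fun_def \<open>0 \<le> c\<close>)
  qed
  then show ?thesis
    using normalised_K_star(1)[OF assms(1,2)] by (metis ereal_less_eq(3))
qed

text \<open>Since \<beta> tends to zero, some \<open>s\<close> has \<open>\<beta> s < v\<close>; the
  term of the supremum at \<open>u = 1 / s\<close> is then positive.\<close>

lemma K_star_pos:
  assumes "normalised \<beta>" "v \<in> {0<..1/4}" "(\<beta> \<longlongrightarrow> 0) at_top"
  shows "0 < real_of_ereal (K_star \<beta> v)"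
proof -
  have "\<forall>\<^sub>F s in at_top. \<beta> s < v"
    using assms(2,3) by (intro order_tendstoD) auto
  then have "\<forall>\<^sub>F s in at_top. \<beta> s < v \<and> 0 < s"
    using eventually_gt_at_top by (rule eventually_conj)
  then obtain s where s: "\<beta> s < v" "0 < s"
    using eventually_happens'[OF trivial_limit_at_top_linorder] by blast
  then have "0 < (1 / s) * v - K_fun \<beta> (1 / s)"
    by (simp add: K_fun_def divide_strict_right_mono)
  also have "\<dots> \<le> real_of_ereal (K_star \<beta> v)"
    using assms s by (intro K_star_upper) auto
  finally show ?thesis .
qed

section \<open>The decreasing function F of a rate and its inverse\<close>

locale rate =
  fixes k :: "real \<Rightarrow> real"
  assumes nonneg: "v \<in> {0..1/4} \<Longrightarrow> 0 \<le> k v"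
    and pos: "v \<in> {0<..1/4} \<Longrightarrow> 0 < k v"
    and le: "v \<in> {0<..1/4} \<Longrightarrow> k v \<le> v"
    and mono: "0 < v \<Longrightarrow> v \<le> w \<Longrightarrow> w \<le> 1/4 \<Longrightarrow> k v \<le> k w"
begin

lemma integrable: "0 < a \<Longrightarrow> b \<le> 1/4 \<Longrightarrow> (\<lambda>v. 1 / k v) integrable_on {a..b}"
proof -
  assume "0 < a" "b \<le> 1/4"
  then have "(\<lambda>v. - (1 / k v)) integrable_on {a..b}"
    by (intro integrable_on_mono_on mono_onI) (auto intro!: divide_left_mono mono pos mult_pos_pos)
  then show ?thesis
    using integrable_neg_iff by fastforce
qed

text \<open>On \<open>{a..b}\<close> the integrand is at least its value at the right endpoint,
  because \<open>k\<close> increases.\<close>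

lemma F_diff:
  assumes "0 < a" "a \<le> b" "b \<le> 1/4"
  shows "(b - a) / k b \<le> F_fun k a - F_fun k b"
proof -
  have "integral {a..b} (\<lambda>v. 1 / k v) + F_fun k b = F_fun k a"
    unfolding F_fun_def using assms by (intro Henstock_Kurzweil_Integration.integral_combine integrable) auto
  moreover have "integral {a..b} (\<lambda>_. 1 / k b) \<le> integral {a..b} (\<lambda>v. 1 / k v)"
    using assms by (intro integral_le integrable) (auto intro!: divide_left_mono mono pos mult_pos_pos)
  ultimately show ?thesis
    using assms by simp
qed

lemma F_strict_antimono:
  assumes "0 < a" "a < b" "b \<le> 1/4"
  shows "F_fun k b < F_fun k a"
proof -
  have "0 < (b - a) / k b"
    using assms pos[of b] by simp
  then show ?thesis
    using F_diff[of a b] assms by simp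
qed

lemma F_inj: "inj_on (F_fun k) {0<..1/4}"
proof (rule inj_onI)
  fix a b assume "a \<in> {0<..1/4}" "b \<in> {0<..1/4}" "F_fun k a = F_fun k b"
  then show "a = b"
    using F_strict_antimono[of a b] F_strict_antimono[of b a] by (cases a b rule: linorder_cases) auto
qed

text \<open>\<open>the_inv_into\<close> is meaningful only on the range. As \<open>F_fun k\<close>
  is continuous and vanishes at \<open>1/4\<close>, the intermediate value theorem finds a preimage
  of \<open>t\<close> to the right of \<open>a\<close>.\<close>

lemma F_inv_ge:
  assumes "0 < a" "a \<le> 1/4" "0 \<le> t" "t \<le> F_fun k a"
  shows "a \<le> F_inv k t"
proof -
  have "continuous_on {a..1/4} (F_fun k)"
    unfolding F_fun_def[abs_def] using assms by (intro indefinite_integral_continuous_1' integrable) auto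
  moreover have "F_fun k (1/4) = 0"
    by (simp add: F_fun_def)
  ultimately obtain x where x: "a \<le> x" "x \<le> 1/4" "F_fun k x = t"
    using IVT2'[of "F_fun k" "1/4" t a] assms by auto
  then show ?thesis
    using the_inv_into_f_f[OF F_inj, of x] assms by (simp add: F_inv_def)
qed

text \<open>Each dyadic interval from \<open>b / 2\<close> to \<open>b\<close> contributes at least
  \<open>1/2\<close> to the integral, because its length is \<open>b / 2\<close> and
  \<open>k b \<le> b\<close>.\<close>

lemma F_unbounded: "real j / 2 \<le> F_fun k ((1/2) ^ j / 4)"
proof (induction j)
  case 0
  then show ?case by (simp add: F_fun_def)
next
  case (Suc j)
  let ?b = "(1/2::real) ^ j / 4"
  have b: "?b \<in> {0<..1/4}"
    by (auto intro!: power_le_one)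
  then have "1 / 2 \<le> (?b - ?b / 2) / k ?b"
    using pos[OF b] le[OF b] by (simp add: field_simps)
  also have "\<dots> \<le> F_fun k (?b / 2) - F_fun k ?b"
    using b by (intro F_diff) auto
  finally show ?case
    using Suc by (simp add: field_simps)
qed

text \<open>Unboundedness of \<open>F_fun k\<close> puts every \<open>t \<ge> 0\<close> into its
  range, so \<open>F_inv\<close> does not take an unspecified value here.\<close>

lemma F_inv_nonneg:
  assumes "0 \<le> t"
  shows "0 \<le> F_inv k t"
proof -
  obtain j :: nat where "2 * t \<le> real j"
    using real_arch_simple by blast
  then have "(1/2) ^ j / 4 \<le> F_inv k t"
    using assms F_unbounded[of j] by (intro F_inv_ge) (auto intro!: power_le_one)
  moreover have "(0::real) \<le> (1/2) ^ j / 4"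
    by simp
  ultimately show ?thesis
    by linarith
qed

text \<open>Each step raises \<open>F (w i)\<close> by at least \<open>1\<close>, as \<open>1 / k \<ge> 1 / k (w i)\<close> on \<open>{w (Suc i)..w i}\<close>.\<close>

lemma iterate_bound:
  assumes w: "\<And>i. w i \<in> {0..1/4}" and step: "\<And>i. k (w i) \<le> w i - w (Suc i)"
  shows "w n \<le> F_inv k (real n)"
\<comment> \<open>\<open>F_fun k\<close> is used at positive points only, so a vanishing term is
  settled by nonnegativity of \<open>F_inv\<close>. A positive term forces all earlier ones to be
  positive, as \<open>w\<close> decreases.\<close>
proof (cases "w n = 0")
  case False
  have dec: "w (Suc i) \<le> w i" for i
    using step[of i] nonneg[OF w[of i]] by linarith
  have "real n \<le> F_fun k (w n)" if "0 < w n" for n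
    using that
  proof (induction n)
    case 0
    have "0 \<le> (1/4 - w 0) / k (1/4)"
      using w[of 0] pos[of "1/4"] by simp
    then show ?case
      using F_diff[of "w 0" "1/4"] w[of 0] 0 by (simp add: F_fun_def[of k "1/4"])
  next
    case (Suc n)
    then have n: "0 < w n"
      using dec[of n] by linarith
    then have "1 \<le> (w n - w (Suc n)) / k (w n)"
      using step[of n] pos[of "w n"] w[of n] by simp
    also have "\<dots> \<le> F_fun k (w (Suc n)) - F_fun k (w n)"
      using dec[of n] w[of n] Suc.prems by (intro F_diff) auto
    finally show ?case
      using Suc.IH[OF n] by simp
  qed
  then show ?thesis
    using w[of n] False by (intro F_inv_ge) auto
qed (simp add: F_inv_nonneg)

end

section \<open>Oscillation\<close>

lemma (in prob_space) osc_le: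
  assumes [measurable]: "g \<in> borel_measurable M" and g: "\<And>x. g x \<in> {a..b}"
  obtains r where "osc M g = ereal r" "0 \<le> r" "r \<le> b - a"
proof -
  let ?S = "esssup M (\<lambda>x. ereal (g x))" and ?I = "esssup M (\<lambda>x. - ereal (g x))"
  have S: "?S \<le> ereal b" and I: "?I \<le> - ereal a"
    using g by (auto intro!: esssup_I AE_I2)
  have "AE x in M. ereal (g x) \<le> ?S \<and> - ereal (g x) \<le> ?I"
    using esssup_AE[of "\<lambda>x. ereal (g x)" M] esssup_AE[of "\<lambda>x. - ereal (g x)" M] by eventually_elim simp
  \<comment> \<open>One point satisfying both essential bounds keeps both suprema away from minus
    infinity and makes the oscillation nonnegative.\<close>
  then obtain x where x: "ereal (g x) \<le> ?S" "- ereal (g x) \<le> ?I"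
    using eventually_happens'[OF ae_filter_bot] by blast
  obtain p where p: "?S = ereal p" "g x \<le> p" "p \<le> b"
    using S x(1) by (cases ?S) auto
  obtain q where q: "?I = ereal q" "- g x \<le> q" "q \<le> - a"
    using I x(2) by (cases ?I) auto
  show thesis
    by (rule that[of "p + q"]) (use p q in \<open>auto simp: osc_def essinf_def\<close>)
qed

lemma (in prob_space) osc_finiteE:
  assumes [measurable]: "f \<in> borel_measurable M" and fin: "osc M f < \<infinity>"
  obtains a b where "osc M f = ereal (b - a)" "AE x in M. f x \<in> {a..b}" "a \<le> b"
proof -
  let ?S = "esssup M (\<lambda>x. ereal (f x))" and ?I = "esssup M (\<lambda>x. - ereal (f x))"
  have AE: "AE x in M. ereal (f x) \<le> ?S \<and> - ereal (f x) \<le> ?I"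
    using esssup_AE[of "\<lambda>x. ereal (f x)" M] esssup_AE[of "\<lambda>x. - ereal (f x)" M] by eventually_elim simp
  then obtain x where x: "ereal (f x) \<le> ?S" "- ereal (f x) \<le> ?I"
    using eventually_happens'[OF ae_filter_bot] by blast
  have "?S \<noteq> \<infinity>" "?I \<noteq> \<infinity>"
    using fin by (auto simp: osc_def essinf_def)
  with x obtain p q where pq: "?S = ereal p" "?I = ereal q" "f x \<le> p" "- f x \<le> q"
    by (cases ?S; cases ?I) auto
  show thesis
  proof (rule that[of p "-q"])
    show "AE x in M. f x \<in> {- q..p}"
      using AE unfolding pq by eventually_elim (auto simp: minus_le_iff)
  qed (use pq in \<open>auto simp: osc_def essinf_def\<close>)
qed

text \<open>Integrating \<open>(b - g x) * (g x - a) \<ge> 0\<close> with mean zero bounds the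
  squared norm by \<open>- (a * b)\<close>, which is at most a quarter of the squared range.\<close>

lemma (in prob_space) popoviciu:
  fixes g :: "'a \<Rightarrow> real"
  assumes [measurable]: "g \<in> borel_measurable M" and g: "\<And>x. g x \<in> {a..b}" and "(\<integral>x. g x \<partial>M) = 0"
  shows "L2_norm_sq M g \<le> (b - a)\<^sup>2 / 4"
proof -
  have B: "\<bar>g x\<bar> \<le> max \<bar>a\<bar> \<bar>b\<bar>" for x
    using g[of x] by auto
  then have "integrable M g"
    by (intro bounded_integrable) auto
  moreover have "g \<in> L2 M"
    using B by (intro L2_bounded) auto
  then have "integrable M (\<lambda>x. (g x)\<^sup>2)"
    by (simp add: L2_def)
  moreover have "0 \<le> (\<integral>x. (b - g x) * (g x - a) \<partial>M)"
    using g by (intro integral_nonneg_AE AE_I2 mult_nonneg_nonneg) auto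
  moreover have "(\<lambda>x. (b - g x) * (g x - a)) = (\<lambda>x. (a + b) * g x - a * b - (g x)\<^sup>2)"
    by (auto simp: algebra_simps power2_eq_square)
  ultimately have "L2_norm_sq M g \<le> - (a * b)"
    using assms(3) by (simp add: L2_norm_sq_def prob_space)
  also have "\<dots> \<le> (b - a)\<^sup>2 / 4"
    using zero_le_power2[of "a + b"] by (simp add: power2_eq_square algebra_simps)
  finally show ?thesis .
qed

section \<open>The two-block Gibbs sampler\<close>

locale two_block = prob_space \<pi> for \<pi> :: "('a::polish_space \<times> 'b::polish_space) measure" +
  fixes \<kappa>YX :: "'a \<Rightarrow> 'b measure" and \<kappa>XY :: "'b \<Rightarrow> 'a measure"
  assumes sets_pi [measurable_cong]: "sets \<pi> = sets borel"
    and cond_YX: "is_cond_distr \<pi> fst snd \<kappa>YX"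
    and cond_XY: "is_cond_distr \<pi> snd fst \<kappa>XY"
begin

sublocale X: disintegration \<pi> fst snd id \<kappa>YX
proof
  show "fst \<in> borel_measurable borel" "snd \<in> borel_measurable borel" "id \<in> borel_measurable (borel :: ('a \<times> 'b) measure)"
    by (rule borel_measurable_continuous_onI; intro continuous_intros continuous_on_id')+
qed (simp_all add: cond_YX sets_pi)

text \<open>Here the conditioning coordinate is the second one, so recombining the pair (condition,
  fibre point) is a swap.\<close>

sublocale Y: disintegration \<pi> snd fst prod.swap \<kappa>XY
proof
  show "fst \<in> borel_measurable borel" "snd \<in> borel_measurable borel" "prod.swap \<in> borel_measurable borel"
    by (rule borel_measurable_continuous_onI; intro continuous_intros continuous_on_swap)+
qed (simp_all add: cond_XY sets_pi)

abbreviation "T1 \<equiv> X.fibre_kernel (\<lambda>x _. \<kappa>YX x)"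
abbreviation "T2 \<equiv> Y.fibre_kernel (\<lambda>y _. \<kappa>XY y)"

sublocale T1: reversible_kernel \<pi> T1
  by (rule X.reversible_fibre_kernel[OF X.kernel_kappa reversible_const])

sublocale T2: reversible_kernel \<pi> T2
  by (rule Y.reversible_fibre_kernel[OF Y.kernel_kappa reversible_const])

lemma borel_measurable_pi [simp]: "borel_measurable \<pi> = borel_measurable borel"
  by (rule measurable_cong_sets[OF sets_pi refl])

lemma space_pi [simp]: "space \<pi> = UNIV"
  using sets_eq_imp_space_eq[OF sets_pi] by simp

lemma op_G1_eq: "f \<in> borel_measurable borel \<Longrightarrow> op_G1 \<kappa>YX f = kernel_op T1 f"
  by (auto simp: X.kernel_op_fibre_kernel[OF X.kernel_kappa] op_G1_def fun_eq_iff)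

lemma op_G2_eq: "f \<in> borel_measurable borel \<Longrightarrow> op_G2 \<kappa>XY f = kernel_op T2 f"
  by (auto simp: Y.kernel_op_fibre_kernel[OF Y.kernel_kappa] op_G2_def fun_eq_iff)

lemma op_G1_idem: "op_G1 \<kappa>YX (op_G1 \<kappa>YX f) = op_G1 \<kappa>YX f"
  by (auto simp: op_G1_def fun_eq_iff prob_space.prob_space[OF X.prob_space_kappa])

text \<open>\<open>L2_adjoint\<close> is a choice, so only its defining property may be used: it
  moves \<open>P\<close> across the inner product and leaves the squared norm of
  \<open>P h\<close>.\<close>

lemma dirichlet_adjoint_P:
  assumes h: "h \<in> L2 \<pi>"
  defines "P \<equiv> op_G1 \<kappa>YX \<circ> op_G2 \<kappa>XY"
  shows "dirichlet \<pi> (L2_adjoint \<pi> P \<circ> P) h = L2_norm_sq \<pi> h - L2_norm_sq \<pi> (kernel_op T1 (kernel_op T2 h))"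
proof -
  have P: "P f = kernel_op T1 (kernel_op T2 f)" and Q: "(op_G2 \<kappa>XY \<circ> op_G1 \<kappa>YX) f = kernel_op T2 (kernel_op T1 f)"
    if "f \<in> L2 \<pi>" for f
  proof -
    have f: "f \<in> borel_measurable borel"
      using that by (simp add: L2_def)
    then have "kernel_op T1 f \<in> borel_measurable borel" "kernel_op T2 f \<in> borel_measurable borel"
      using T1.kernel_op_measurable[of f] T2.kernel_op_measurable[of f] by simp_all
    with f show "P f = kernel_op T1 (kernel_op T2 f)" "(op_G2 \<kappa>XY \<circ> op_G1 \<kappa>YX) f = kernel_op T2 (kernel_op T1 f)"
      by (simp_all only: P_def o_apply op_G1_eq op_G2_eq)
  qed
  note L = T1.kernel_op_L2(1) T2.kernel_op_L2(1)
  \<comment> \<open>Reversing the order of the two self-adjoint factors gives an adjoint, so the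
    choice is not vacuous.\<close>
  have "is_L2_adjoint \<pi> P (op_G2 \<kappa>XY \<circ> op_G1 \<kappa>YX)"
    unfolding is_L2_adjoint_def
    by (auto simp: P Q[unfolded o_def] L T1.kernel_op_selfadjoint T2.kernel_op_selfadjoint)
  then have adj: "is_L2_adjoint \<pi> P (L2_adjoint \<pi> P)"
    unfolding L2_adjoint_def by (rule someI[where P="is_L2_adjoint \<pi> P"])
  have Ph: "P h \<in> L2 \<pi>"
    by (simp add: P h L)
  then have "L2_inner \<pi> h (L2_adjoint \<pi> P (P h)) = L2_norm_sq \<pi> (P h)"
    using adj h by (simp add: is_L2_adjoint_def L2_norm_sq_inner)
  moreover have "L2_adjoint \<pi> P (P h) \<in> L2 \<pi>"
    using adj Ph by (simp add: is_L2_adjoint_def)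
  ultimately show ?thesis
    by (simp add: dirichlet_eq h L2_inner_commute[of _ _ h] P)
qed

end

section \<open>The hybrid sampler and its averaged rate\<close>

locale hybrid_gibbs = two_block \<pi> \<kappa>YX \<kappa>XY
  for \<pi> :: "('a::polish_space \<times> 'b::polish_space) measure" and \<kappa>YX \<kappa>XY +
  fixes H2 :: "'b \<Rightarrow> 'a \<Rightarrow> 'a measure" and \<beta>0 :: "real \<Rightarrow> real" and \<beta>2 :: "real \<Rightarrow> 'b \<Rightarrow> real"
  assumes H2_kernel: "(\<lambda>(x, y). H2 y x) \<in> borel \<rightarrow>\<^sub>M prob_algebra borel"
    and H2_reversible: "\<And>y. reversible (\<kappa>XY y) (H2 y)"
    and H2_positive: "\<And>y. positive_kernel (\<kappa>XY y) (H2 y)"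
    and \<beta>2_admissible: "\<And>y. admissible (\<lambda>s. \<beta>2 s y)"
    and \<beta>2_measurable: "\<And>s. s > 0 \<Longrightarrow> \<beta>2 s \<in> borel_measurable borel"
    and H2_weak_poincare: "\<And>y s g. s > 0 \<Longrightarrow> g \<in> L2 (\<kappa>XY y) \<Longrightarrow>
           ereal (prob_space.variance (\<kappa>XY y) g)
             \<le> ereal (s * dirichlet (\<kappa>XY y) (kernel_op (H2 y)) g)
                + ereal (\<beta>2 s y) * (osc (\<kappa>XY y) g)\<^sup>2"
    and \<beta>0_admissible: "admissible \<beta>0"
    and gibbs_weak_poincare: "\<And>s h. s > 0 \<Longrightarrow> h \<in> L2_zero \<pi> \<Longrightarrow>
           ereal (L2_norm_sq \<pi> h)
             \<le> ereal (s * dirichlet \<pi>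
                    (L2_adjoint \<pi> (op_G1 \<kappa>YX \<circ> op_G2 \<kappa>XY) \<circ> (op_G1 \<kappa>YX \<circ> op_G2 \<kappa>XY)) h)
                + ereal (\<beta>0 s) * (osc \<pi> h)\<^sup>2"
    and \<beta>0_normalised: "normalised \<beta>0"
    and \<beta>2_normalised: "normalised (\<lambda>s. \<integral>y. \<beta>2 s y \<partial>distr \<pi> borel snd)"
begin

lemma kernel_H2: "(\<lambda>(y, x). H2 y x) \<in> borel \<rightarrow>\<^sub>M prob_algebra borel"
  using measurable_compose[OF borel_measurable_continuous_onI[OF continuous_on_swap] H2_kernel]
  by (simp add: case_prod_unfold)

abbreviation "TH \<equiv> Y.fibre_kernel H2"

sublocale TH: reversible_kernel \<pi> TH
  by (rule Y.reversible_fibre_kernel[OF kernel_H2 H2_reversible])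

lemma reversible_kernel_H2: "reversible_kernel (\<kappa>XY y) (H2 y)"
  by (rule Y.reversible_kernel_fibre[OF kernel_H2 H2_reversible])

lemma op_H2_eq: "f \<in> borel_measurable borel \<Longrightarrow> op_H2 H2 f = kernel_op TH f"
  by (auto simp: Y.kernel_op_fibre_kernel[OF kernel_H2] op_H2_def fun_eq_iff)

definition \<beta>2' :: "real \<Rightarrow> real" where
  "\<beta>2' s = (\<integral>y. \<beta>2 s y \<partial>distr \<pi> borel snd)"

lemma \<beta>2'_eq: "\<beta>2' s = (\<integral>y. \<beta>2 s y \<partial>Y.N)"
  by (simp add: \<beta>2'_def Y.N_def)

lemma \<beta>2_bounds: "s > 0 \<Longrightarrow> \<bar>\<beta>2 s y\<bar> \<le> 1/4"
  using \<beta>2_admissible[of y] by (simp add: admissible_def)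

lemma integrable_\<beta>2: "s > 0 \<Longrightarrow> integrable Y.N (\<beta>2 s)"
  by (rule prob_space.bounded_integrable[OF Y.prob_space_N _ \<beta>2_bounds])
     (simp_all add: measurable_cong_sets[OF Y.sets_N refl] \<beta>2_measurable)

lemma \<beta>2'_tendsto: "(\<beta>2' \<longlongrightarrow> 0) at_top"
proof -
  interpret N: prob_space Y.N by (rule Y.prob_space_N)
  \<comment> \<open>Nothing is known of \<beta>2 at nonpositive \<open>s\<close>, so it is set to
    zero there; the limit at infinity does not see the change.\<close>
  define b where "b s = (if s > 0 then \<beta>2 s else (\<lambda>_. 0))" for s
  have "((\<lambda>s. \<integral>y. b s y \<partial>Y.N) \<longlongrightarrow> (\<integral>y. 0 \<partial>Y.N)) at_top"
  proof (rule integral_dominated_convergence_at_top)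
    show "integrable Y.N (\<lambda>_. 1/4 :: real)" by simp
    show "b s \<in> borel_measurable Y.N" for s
      using \<beta>2_measurable by (auto simp: b_def Y.sets_N cong: measurable_cong_sets)
    show "\<forall>\<^sub>F s in at_top. AE y in Y.N. norm (b s y) \<le> 1/4"
      using \<beta>2_bounds by (auto simp: b_def intro!: always_eventually)
    show "AE y in Y.N. ((\<lambda>s. b s y) \<longlongrightarrow> 0) at_top"
    proof (rule AE_I2)
      fix y
      have "\<forall>\<^sub>F s in at_top. \<beta>2 s y = b s y"
        using eventually_gt_at_top[of 0] by eventually_elim (simp add: b_def)
      then show "((\<lambda>s. b s y) \<longlongrightarrow> 0) at_top"
        by (rule Lim_transform_eventually[rotated]) (use \<beta>2_admissible[of y] in \<open>simp add: admissible_def\<close>)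
    qed
  qed simp
  moreover have "\<forall>\<^sub>F s in at_top. (\<integral>y. b s y \<partial>Y.N) = \<beta>2' s"
    using eventually_gt_at_top[of 0] by eventually_elim (simp add: b_def \<beta>2'_eq)
  ultimately have "(\<beta>2' \<longlongrightarrow> (\<integral>y. 0 \<partial>Y.N)) at_top"
    by (rule Lim_transform_eventually)
  then show ?thesis
    by simp
qed

lemma \<beta>2'_normalised: "normalised \<beta>2'"
  using \<beta>2_normalised by (simp add: \<beta>2'_def[abs_def])

text \<open>Keeps the argument of the outer \<open>K_star\<close> in the interval on which
  normalisation controls it.\<close>

lemma half_K_star:
  assumes "v \<in> {0..1/4}"
  shows "1/2 * real_of_ereal (K_star \<beta>0 v) \<in> {0..1/4}" "1/2 * real_of_ereal (K_star \<beta>0 v) \<le> v"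
  using normalised_K_star[OF \<beta>0_normalised assms] assms by auto

sublocale rate: rate "K_star_comp \<beta>2' \<beta>0"
proof
  fix v w :: real
  show "0 \<le> K_star_comp \<beta>2' \<beta>0 v" if "v \<in> {0..1/4}"
    unfolding K_star_comp_def by (rule normalised_K_star(2)[OF \<beta>2'_normalised half_K_star(1)[OF that]])
  show "0 < K_star_comp \<beta>2' \<beta>0 v" if v: "v \<in> {0<..1/4}"
  proof -
    have "0 < real_of_ereal (K_star \<beta>0 v)"
      using \<beta>0_admissible v by (intro K_star_pos \<beta>0_normalised) (auto simp: admissible_def)
    then show ?thesis
      unfolding K_star_comp_def using half_K_star(1)[of v] v
      by (intro K_star_pos \<beta>2'_normalised \<beta>2'_tendsto) auto
  qed
  show "K_star_comp \<beta>2' \<beta>0 v \<le> v" if "v \<in> {0<..1/4}"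
    unfolding K_star_comp_def
    by (rule order_trans[OF normalised_K_star(3)[OF \<beta>2'_normalised half_K_star(1)] half_K_star(2)])
       (use that in auto)
  show "K_star_comp \<beta>2' \<beta>0 v \<le> K_star_comp \<beta>2' \<beta>0 w" if "0 < v" "v \<le> w" "w \<le> 1/4"
    unfolding K_star_comp_def using half_K_star(1)[of v] half_K_star(1)[of w] that
    by (intro K_star_mono \<beta>2'_normalised mult_left_mono \<beta>0_normalised) auto
qed

section \<open>One step of the sampler on a bounded function\<close>

context
  fixes h :: "'a \<times> 'b \<Rightarrow> real" and a b :: real
  assumes h [measurable]: "h \<in> borel_measurable borel" and h_between: "\<And>z. h z \<in> {a..b}"
begin

lemma between_bounded: "\<bar>h z\<bar> \<le> max \<bar>a\<bar> \<bar>b\<bar>"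
  using h_between[of z] by auto

lemma between_L2: "h \<in> L2 \<pi>"
  using h between_bounded by (intro L2_bounded) auto

text \<open>The bounds on \<open>h\<close> hold at every point, so every fibre is covered and the
  fibrewise Poincare inequality applies at each \<open>y\<close> without exceptional sets.\<close>

lemma between_fibre_L2: "(\<lambda>x. h (x, y)) \<in> L2 (\<kappa>XY y)"
proof (rule finite_measure.L2_bounded[OF prob_space.finite_measure[OF Y.prob_space_kappa]])
  have "(\<lambda>x. h (x, y)) \<in> borel_measurable borel"
    by (rule measurable_compose[OF borel_measurable_continuous_onI h]) (intro continuous_intros)
  then show "(\<lambda>x. h (x, y)) \<in> borel_measurable (\<kappa>XY y)"
    by (simp add: measurable_cong_sets[OF Y.sets_kappa refl])
qed (rule between_bounded)

lemma kernel_op_between: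
  assumes "reversible_kernel \<pi> T"
  shows "kernel_op T h \<in> borel_measurable borel" "kernel_op T h z \<in> {a..b}" "\<bar>kernel_op T h z\<bar> \<le> max \<bar>a\<bar> \<bar>b\<bar>"
proof -
  interpret T: reversible_kernel \<pi> T by fact
  show "kernel_op T h \<in> borel_measurable borel"
    using T.kernel_op_measurable[of h] h by simp
  show "kernel_op T h z \<in> {a..b}"
    using T.kernel_op_between[of h a b z] h h_between by simp
  then show "\<bar>kernel_op T h z\<bar> \<le> max \<bar>a\<bar> \<bar>b\<bar>"
    by auto
qed

text \<open>The inequality for positive reversible kernels holds on each fibre and is integrated
  over \<open>y\<close>.\<close>

lemma H2_contraction: "L2_norm_sq \<pi> (kernel_op TH h) \<le> L2_inner \<pi> (kernel_op TH h) h"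
proof -
  note TH = kernel_op_between[OF TH.reversible_kernel_axioms]
  have *: "kernel_op TH h (prod.swap (y, x)) = kernel_op (H2 y) (\<lambda>x. h (prod.swap (y, x))) x" for x y
    by (rule Y.kernel_op_fibre_kernel_e[OF kernel_H2 h])
  show ?thesis
    unfolding L2_norm_sq_inner Y.L2_inner_fibres(1)[OF TH(1) TH(1) TH(3) TH(3)] 
      Y.L2_inner_fibres(1)[OF TH(1) h TH(3) between_bounded]
  proof (rule integral_mono[OF Y.L2_inner_fibres(2)[OF TH(1) TH(1) TH(3) TH(3)]
        Y.L2_inner_fibres(2)[OF TH(1) h TH(3) between_bounded]])
    fix y
    show "L2_inner (\<kappa>XY y) (\<lambda>x. kernel_op TH h (prod.swap (y, x))) (\<lambda>x. kernel_op TH h (prod.swap (y, x)))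
        \<le> L2_inner (\<kappa>XY y) (\<lambda>x. kernel_op TH h (prod.swap (y, x))) (\<lambda>x. h (prod.swap (y, x)))"
      using reversible_kernel.L2_norm_sq_kernel_le_inner[OF reversible_kernel_H2 H2_positive between_fibre_L2]
      unfolding * L2_norm_sq_inner by simp
  qed
qed

text \<open>Integrate the fibrewise inequalities over \<open>y\<close>. Both Dirichlet forms are
  means over the fibres, \<open>b - a\<close> bounds every fibre oscillation, and the mean of
  \<beta>2 is \<open>\<beta>2' s\<close>.\<close>

lemma integrated_weak_poincare:
  assumes s: "s > 0"
  shows "L2_norm_sq \<pi> h - L2_inner \<pi> (kernel_op T2 h) h
    \<le> s * (L2_norm_sq \<pi> h - L2_inner \<pi> (kernel_op TH h) h) + \<beta>2' s * (b - a)\<^sup>2"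
proof -
  note TH = kernel_op_between[OF TH.reversible_kernel_axioms]
  note T2 = kernel_op_between[OF T2.reversible_kernel_axioms]
  let ?n = "\<lambda>y. L2_inner (\<kappa>XY y) (\<lambda>x. h (prod.swap (y, x))) (\<lambda>x. h (prod.swap (y, x)))"
  let ?g = "\<lambda>y. L2_inner (\<kappa>XY y) (\<lambda>x. kernel_op T2 h (prod.swap (y, x))) (\<lambda>x. h (prod.swap (y, x)))"
  let ?h = "\<lambda>y. L2_inner (\<kappa>XY y) (\<lambda>x. kernel_op TH h (prod.swap (y, x))) (\<lambda>x. h (prod.swap (y, x)))"
  note int = Y.L2_inner_fibres(2)[OF h h between_bounded between_bounded]
    Y.L2_inner_fibres(2)[OF T2(1) h T2(3) between_bounded] Y.L2_inner_fibres(2)[OF TH(1) h TH(3) between_bounded]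
    integrable_\<beta>2[OF s]
  have "?n y - ?g y \<le> s * (?n y - ?h y) + \<beta>2 s y * (b - a)\<^sup>2" for y
  proof -
    interpret \<kappa>: prob_space "\<kappa>XY y" by (rule Y.prob_space_kappa)
    interpret H: reversible_kernel "\<kappa>XY y" "H2 y" by (rule reversible_kernel_H2)
    let ?u = "\<lambda>x. h (x, y)"
    have u: "?u \<in> L2 (\<kappa>XY y)" by (rule between_fibre_L2)
    then have um: "?u \<in> borel_measurable (\<kappa>XY y)" and u2: "integrable (\<kappa>XY y) (\<lambda>x. (?u x)\<^sup>2)"
      by (auto simp: L2_def)
    then have u1: "integrable (\<kappa>XY y) ?u"
      by (rule \<kappa>.square_integrable_imp_integrable)
    have "kernel_op T2 h (prod.swap (y, x)) = (\<integral>x'. ?u x' \<partial>\<kappa>XY y)" for x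
      by (subst Y.kernel_op_fibre_kernel_e[OF Y.kernel_kappa h]) (simp add: kernel_op_def)
    \<comment> \<open>On the fibre the exact update of \<open>h\<close> is the constant mean of
      \<open>?u\<close>, so its pairing with \<open>h\<close> is the squared mean.\<close>
    then have "?n y - ?g y = \<kappa>.variance ?u"
      by (subst \<kappa>.variance_eq[OF u1 u2]) (simp add: L2_inner_def power2_eq_square)
    moreover have "kernel_op TH h (prod.swap (y, x)) = kernel_op (H2 y) ?u x" for x
      by (subst Y.kernel_op_fibre_kernel_e[OF kernel_H2 h]) simp
    then have "?n y - ?h y = dirichlet (\<kappa>XY y) (kernel_op (H2 y)) ?u"
      by (simp add: dirichlet_eq[where T="kernel_op (H2 y)", OF u H.kernel_op_L2(1)[OF u]] L2_norm_sq_inner)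
    moreover obtain r where r: "osc (\<kappa>XY y) ?u = ereal r" "0 \<le> r" "r \<le> b - a"
      using \<kappa>.osc_le[OF um h_between] .
    ultimately have "?n y - ?g y \<le> s * (?n y - ?h y) + \<beta>2 s y * r\<^sup>2"
      using H2_weak_poincare[OF s u] by simp
    also have "\<beta>2 s y * r\<^sup>2 \<le> \<beta>2 s y * (b - a)\<^sup>2"
      using r \<beta>2_admissible[of y] s by (intro mult_left_mono power_mono) (auto simp: admissible_def)
    finally show ?thesis by simp
  qed
  then have "(\<integral>y. ?n y - ?g y \<partial>Y.N) \<le> (\<integral>y. s * (?n y - ?h y) + \<beta>2 s y * (b - a)\<^sup>2 \<partial>Y.N)"
    using int by (intro integral_mono) auto
  then show ?thesis
    unfolding L2_norm_sq_inner Y.L2_inner_fibres(1)[OF h h between_bounded between_bounded] \<beta>2'_eq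
      Y.L2_inner_fibres(1)[OF T2(1) h T2(3) between_bounded] Y.L2_inner_fibres(1)[OF TH(1) h TH(3) between_bounded]
    using int by simp
qed

text \<open>
  On functions \<open>h\<close> fixed by \<open>G1\<close> the exact sampler acts as the self-adjoint contraction
  \<open>S = G1 G2 G1\<close>, and \<open>1 - \<lambda>\<^sup>2 \<le> 2 (1 - \<lambda>)\<close> on its spectrum; hence the factor \<open>1/2\<close> in \<open>K*\<close>.
\<close>

lemma gibbs_gap:
  assumes s: "s > 0" and fixed: "kernel_op T1 h = h" and mean: "(\<integral>z. h z \<partial>\<pi>) = 0"
  shows "L2_norm_sq \<pi> h \<le> s * (2 * (L2_norm_sq \<pi> h - L2_inner \<pi> (kernel_op T2 h) h)) + \<beta>0 s * (b - a)\<^sup>2"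
proof -
  let ?S = "kernel_op T1 (kernel_op T2 h)"
  have T2: "kernel_op T2 h \<in> L2 \<pi>" and S: "?S \<in> L2 \<pi>"
    by (intro T1.kernel_op_L2 T2.kernel_op_L2 between_L2)+
  \<comment> \<open>Self-adjointness moves the outer \<open>T1\<close> onto \<open>h\<close>, where
    it acts trivially.\<close>
  have "L2_inner \<pi> ?S h = L2_inner \<pi> (kernel_op T2 h) h"
    using T1.kernel_op_selfadjoint[OF T2 between_L2] by (simp add: fixed)
  \<comment> \<open>A rearrangement of nonnegativity of the squared norm of \<open>?S - h\<close>,
    replacing the spectral argument.\<close>
  then have gap: "L2_norm_sq \<pi> h - L2_norm_sq \<pi> ?S \<le> 2 * (L2_norm_sq \<pi> h - L2_inner \<pi> (kernel_op T2 h) h)"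
    using L2_inner_le[OF S between_L2] by simp
  obtain r where r: "osc \<pi> h = ereal r" "0 \<le> r" "r \<le> b - a"
    using osc_le[of h a b] h h_between by auto
  have "h \<in> L2_zero \<pi>"
    using between_L2 mean by (simp add: L2_zero_def)
  then have "L2_norm_sq \<pi> h \<le> s * (L2_norm_sq \<pi> h - L2_norm_sq \<pi> ?S) + \<beta>0 s * r\<^sup>2"
    using gibbs_weak_poincare[OF s, of h] by (simp add: dirichlet_adjoint_P[OF between_L2] r del: o_apply)
  also have "\<dots> \<le> s * (2 * (L2_norm_sq \<pi> h - L2_inner \<pi> (kernel_op T2 h) h)) + \<beta>0 s * (b - a)\<^sup>2"
    using gap s r \<beta>0_admissible
    by (intro add_mono mult_left_mono power_mono) (auto simp: admissible_def)
  finally show ?thesis .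
qed

text \<open>Scaled Dirichlet forms connect the two transforms: \<open>c\<close> belongs to the exact
  update and \<open>d\<close> to the approximate one. Dualising in \<open>s\<close> twice leads from
  \<open>v\<close> to \<open>c\<close> and from \<open>c\<close> to \<open>d\<close>, and
  \<open>d\<close> is at most the loss of squared norm in one step.\<close>

lemma K_star_comp_le_decrement:
  assumes ab: "a < b" and fixed: "kernel_op T1 h = h" and mean: "(\<integral>z. h z \<partial>\<pi>) = 0"
  defines "v \<equiv> L2_norm_sq \<pi> h / (b - a)\<^sup>2"
  shows "v \<in> {0..1/4}"
    and "K_star_comp \<beta>2' \<beta>0 v \<le> v - L2_norm_sq \<pi> (kernel_op T1 (kernel_op TH h)) / (b - a)\<^sup>2"
proof -
  define D where "D = (b - a)\<^sup>2"
  have D: "0 < D"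
    using ab by (simp add: D_def)
  have vD: "v = L2_norm_sq \<pi> h / D"
    by (simp add: v_def D_def)
  \<comment> \<open>The range of \<open>v\<close> is needed first, since normalisation speaks only
    of arguments up to \<open>1/4\<close>.\<close>
  have "L2_norm_sq \<pi> h \<le> D / 4"
    using popoviciu[of h a b] h h_between mean by (simp add: D_def)
  then show v: "v \<in> {0..1/4}"
    using D by (simp add: vD field_simps)
  define c where "c = (L2_norm_sq \<pi> h - L2_inner \<pi> (kernel_op T2 h) h) / D"
  define d where "d = (L2_norm_sq \<pi> h - L2_inner \<pi> (kernel_op TH h) h) / D"
  have "0 \<le> c"
    using L2_inner_le[OF T2.kernel_op_L2(1)[OF between_L2] between_L2] T2.kernel_op_L2(2)[OF between_L2] D by (simp add: c_def)
  have "0 \<le> d"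
    using L2_inner_le[OF TH.kernel_op_L2(1)[OF between_L2] between_L2] TH.kernel_op_L2(2)[OF between_L2] D by (simp add: d_def)
  have "real_of_ereal (K_star \<beta>0 v) \<le> 2 * c"
  proof (rule K_star_le[OF \<beta>0_normalised v])
    fix s :: real assume "0 < s"
    from gibbs_gap[OF this fixed mean] show "v \<le> s * (2 * c) + \<beta>0 s"
      using D by (simp add: vD c_def D_def[symmetric] field_simps)
  qed (use \<open>0 \<le> c\<close> in simp)
  then have c: "1/2 * real_of_ereal (K_star \<beta>0 v) \<le> c"
    by simp
  have "K_star_comp \<beta>2' \<beta>0 v \<le> d"
    unfolding K_star_comp_def
  proof (rule K_star_le[OF \<beta>2'_normalised half_K_star(1)[OF v] \<open>0 \<le> d\<close>])
    fix s :: real assume "0 < s"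
    have "c \<le> s * d + \<beta>2' s"
      using divide_right_mono[OF integrated_weak_poincare[OF \<open>0 < s\<close>], of D] D
      by (simp add: c_def d_def D_def[symmetric] add_divide_distrib)
    with c show "1/2 * real_of_ereal (K_star \<beta>0 v) \<le> s * d + \<beta>2' s"
      by linarith
  qed
  \<comment> \<open>\<open>H2_contraction\<close> replaces the pairing in \<open>d\<close> by the
    squared norm after \<open>TH\<close>, and \<open>T1\<close> only decreases that norm.\<close>
  also have "d \<le> v - L2_norm_sq \<pi> (kernel_op T1 (kernel_op TH h)) / D"
    using H2_contraction T1.kernel_op_L2(2)[OF TH.kernel_op_L2(1)[OF between_L2]] D
    by (simp add: d_def vD diff_divide_distrib[symmetric] divide_right_mono)
  finally show "K_star_comp \<beta>2' \<beta>0 v \<le> v - L2_norm_sq \<pi> (kernel_op T1 (kernel_op TH h)) / (b - a)\<^sup>2"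
    by (simp add: D_def)
qed

end

section \<open>Iterates of the hybrid sampler\<close>

definition P2 :: "('a \<times> 'b \<Rightarrow> real) \<Rightarrow> 'a \<times> 'b \<Rightarrow> real" where
  "P2 f = kernel_op T1 (kernel_op TH f)"

lemma P2_measurable: "f \<in> borel_measurable borel \<Longrightarrow> P2 f \<in> borel_measurable borel"
  using T1.kernel_op_measurable[of "kernel_op TH f"] TH.kernel_op_measurable[of f] by (simp add: P2_def)

lemma op_P2: "f \<in> borel_measurable borel \<Longrightarrow> op_G1 \<kappa>YX (op_H2 H2 f) = P2 f"
  using TH.kernel_op_measurable[of f] by (simp add: P2_def op_H2_eq op_G1_eq)

lemma P2_cong_AE:
  assumes "AE z in \<pi>. f z = g z" "f \<in> borel_measurable borel" "g \<in> borel_measurable borel"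
  shows "AE z in \<pi>. P2 f z = P2 g z"
  unfolding P2_def using assms
  by (intro T1.kernel_op_cong_AE TH.kernel_op_cong_AE TH.kernel_op_measurable) simp_all

lemma P2_pow_measurable: "f \<in> borel_measurable borel \<Longrightarrow> (P2 ^^ n) f \<in> borel_measurable borel"
  by (induction n) (simp_all add: P2_measurable)

lemma op_P2_pow: "f \<in> borel_measurable borel \<Longrightarrow> ((op_G1 \<kappa>YX \<circ> op_H2 H2) ^^ n) f = (P2 ^^ n) f"
  by (induction n) (simp_all add: op_P2 P2_pow_measurable)

text \<open>Permits replacing the given function by an everywhere bounded version.\<close>

lemma P2_pow_cong_AE:
  assumes "AE z in \<pi>. f z = g z" "f \<in> borel_measurable borel" "g \<in> borel_measurable borel"
  shows "AE z in \<pi>. (P2 ^^ n) f z = (P2 ^^ n) g z"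
proof (induction n)
  case (Suc n)
  then show ?case
    using P2_cong_AE[OF _ P2_pow_measurable P2_pow_measurable] assms(2,3) by simp
qed (use assms in simp)

lemma P2_pow_between:
  assumes g: "g \<in> borel_measurable borel" "\<And>z. g z \<in> {a..b}"
  shows "(P2 ^^ n) g z \<in> {a..b}"
proof (induction n arbitrary: z)
  case (Suc n)
  note TH = kernel_op_between[OF P2_pow_measurable[OF g(1)] Suc TH.reversible_kernel_axioms]
  show ?case
    using kernel_op_between(2)[OF TH(1,2) T1.reversible_kernel_axioms] by (simp add: P2_def[of "(P2 ^^ n) g"])
qed (use g(2) in simp)

lemma integral_P2:
  assumes "f \<in> L2 \<pi>"
  shows "(\<integral>z. P2 f z \<partial>\<pi>) = (\<integral>z. f z \<partial>\<pi>)"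
  unfolding P2_def
  using T1.integral_kernel_op[OF TH.kernel_op_L2(1)[OF assms]] TH.integral_kernel_op[OF assms] by simp

lemma integral_P2_pow:
  assumes g: "g \<in> borel_measurable borel" "\<And>z. g z \<in> {a..b}"
  shows "(\<integral>z. (P2 ^^ n) g z \<partial>\<pi>) = (\<integral>z. g z \<partial>\<pi>)"
proof (induction n)
  case (Suc n)
  have "(P2 ^^ n) g \<in> L2 \<pi>"
    by (rule between_L2[OF P2_pow_measurable[OF g(1)] P2_pow_between[OF g]])
  from integral_P2[OF this] Suc show ?case
    by simp
qed simp

text \<open>The image of \<open>P2\<close> lies in the range of the idempotent \<open>op_G1\<close>.
  A starting function need not be fixed in this way, so the first application of \<open>P2\<close>
  is spent on reaching that range.\<close>

lemma P2_fixed: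
  assumes f: "f \<in> borel_measurable borel"
  shows "kernel_op T1 (P2 f) = P2 f"
proof -
  have "kernel_op TH f \<in> borel_measurable borel"
    using TH.kernel_op_measurable[of f] f by simp
  then have "P2 f = op_G1 \<kappa>YX (kernel_op TH f)"
    by (simp add: P2_def op_G1_eq)
  then show ?thesis
    using op_G1_eq[OF P2_measurable[OF f]] op_G1_idem by metis
qed

lemma P2_pow_bound:
  assumes f: "f \<in> L2_zero \<pi>" and osc: "0 < osc \<pi> f" "osc \<pi> f < \<infinity>" and n: "n \<ge> 1"
  shows "ereal (L2_norm_sq \<pi> (((op_G1 \<kappa>YX \<circ> op_H2 H2) ^^ n) f))
    \<le> (osc \<pi> f)\<^sup>2 * ereal (F_inv (K_star_comp \<beta>2' \<beta>0) (real n - 1))"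
proof -
  have fm [measurable]: "f \<in> borel_measurable borel" and mean: "(\<integral>z. f z \<partial>\<pi>) = 0"
    using f by (auto simp: L2_zero_def L2_def)
  have "f \<in> borel_measurable \<pi>"
    by simp
  then obtain a b where ab: "osc \<pi> f = ereal (b - a)" "AE z in \<pi>. f z \<in> {a..b}" "a \<le> b"
    by (rule osc_finiteE[OF _ osc(2)])
  then have "a < b"
    using osc(1) by simp
  \<comment> \<open>a version of \<open>f\<close> whose iterates are bounded, hence integrable, on every single fibre\<close>
  define g where "g = (\<lambda>z. max a (min b (f z)))"
  have gm: "g \<in> borel_measurable borel"
    unfolding g_def by measurable
  have g: "g z \<in> {a..b}" for z
    using \<open>a < b\<close> by (auto simp: g_def)
  have eq: "AE z in \<pi>. f z = g z"
    using ab(2) by eventually_elim (auto simp: g_def)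
  then have g0: "(\<integral>z. g z \<partial>\<pi>) = 0"
    using integral_cong_AE[of f \<pi> g] fm gm mean by simp
  \<comment> \<open>The sequence starts at the first iterate, the first one known to be fixed by
    \<open>T1\<close>. Hence the \<open>n\<close>-th iterate is \<open>w (n - 1)\<close>, reached
    after \<open>n - 1\<close> decrements.\<close>
  define w where "w i = L2_norm_sq \<pi> ((P2 ^^ Suc i) g) / (b - a)\<^sup>2" for i
  have step: "w i \<in> {0..1/4}" "K_star_comp \<beta>2' \<beta>0 (w i) \<le> w i - w (Suc i)" for i
  proof -
    have fixed: "kernel_op T1 ((P2 ^^ Suc i) g) = (P2 ^^ Suc i) g"
      using P2_fixed[OF P2_pow_measurable[OF gm]] by simp
    have mean: "(\<integral>z. (P2 ^^ Suc i) g z \<partial>\<pi>) = 0"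
      using integral_P2_pow[OF gm g, of "Suc i"] g0 by (rule trans)
    note step = K_star_comp_le_decrement[OF P2_pow_measurable[OF gm] P2_pow_between[OF gm g] \<open>a < b\<close> fixed mean]
    show "w i \<in> {0..1/4}" "K_star_comp \<beta>2' \<beta>0 (w i) \<le> w i - w (Suc i)"
      unfolding w_def using step by (simp_all add: P2_def[symmetric])
  qed
  have "w (n - 1) \<le> F_inv (K_star_comp \<beta>2' \<beta>0) (real (n - 1))"
    by (rule rate.iterate_bound[of w, OF step])
  then have "L2_norm_sq \<pi> ((P2 ^^ n) g) \<le> (b - a)\<^sup>2 * F_inv (K_star_comp \<beta>2' \<beta>0) (real n - 1)"
    using n \<open>a < b\<close> by (simp add: w_def field_simps of_nat_diff del: funpow.simps)
  moreover have "L2_norm_sq \<pi> ((P2 ^^ n) f) = L2_norm_sq \<pi> ((P2 ^^ n) g)"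
    unfolding L2_norm_sq_def using P2_pow_measurable[OF fm] P2_pow_measurable[OF gm] P2_pow_cong_AE[OF eq fm gm, of n]
    by (intro integral_cong_AE) auto
  ultimately show ?thesis
    by (simp add: op_P2_pow[OF fm] ab(1))
qed

end

theorem corollary3p4:
  fixes \<pi> :: "('a::polish_space \<times> 'b::polish_space) measure"
    and \<kappa>YX :: "'a \<Rightarrow> 'b measure"
    and \<kappa>XY :: "'b \<Rightarrow> 'a measure"
    and H2 :: "'b \<Rightarrow> 'a \<Rightarrow> 'a measure"
    and \<beta>0 :: "real \<Rightarrow> real"
    and \<beta>2 :: "real \<Rightarrow> 'b \<Rightarrow> real"
    and f :: "'a \<times> 'b \<Rightarrow> real"
    and n :: nat
  assumes "prob_space \<pi>" and "sets \<pi> = sets borel"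
    and "is_cond_distr \<pi> fst snd \<kappa>YX"
    and "is_cond_distr \<pi> snd fst \<kappa>XY"
    and "(\<lambda>(x, y). H2 y x) \<in> borel \<rightarrow>\<^sub>M prob_algebra borel"
    and "\<And>y. reversible (\<kappa>XY y) (H2 y)"
    and "\<And>y. positive_kernel (\<kappa>XY y) (H2 y)"
    and "\<And>y. admissible (\<lambda>s. \<beta>2 s y)"
    and "\<And>s. s > 0 \<Longrightarrow> \<beta>2 s \<in> borel_measurable borel"
    and "\<And>y s g. s > 0 \<Longrightarrow> g \<in> L2 (\<kappa>XY y) \<Longrightarrow>
           ereal (prob_space.variance (\<kappa>XY y) g)
             \<le> ereal (s * dirichlet (\<kappa>XY y) (kernel_op (H2 y)) g)
                + ereal (\<beta>2 s y) * (osc (\<kappa>XY y) g)\<^sup>2"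
    and "admissible \<beta>0"
    and "\<And>s h. s > 0 \<Longrightarrow> h \<in> L2_zero \<pi> \<Longrightarrow>
           ereal (L2_norm_sq \<pi> h)
             \<le> ereal (s * dirichlet \<pi>
                    (L2_adjoint \<pi> (op_G1 \<kappa>YX \<circ> op_G2 \<kappa>XY) \<circ> (op_G1 \<kappa>YX \<circ> op_G2 \<kappa>XY)) h)
                + ereal (\<beta>0 s) * (osc \<pi> h)\<^sup>2"
    and "normalised \<beta>0"
    and "normalised (\<lambda>s. \<integral>y. \<beta>2 s y \<partial>distr \<pi> borel snd)"
    and "f \<in> L2_zero \<pi>" and "0 < osc \<pi> f" and "osc \<pi> f < \<infinity>"
    and "n \<ge> 2"
  shows "ereal (L2_norm_sq \<pi> (((op_G1 \<kappa>YX \<circ> op_H2 H2) ^^ n) f))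
           \<le> (osc \<pi> f)\<^sup>2 *
              ereal (F_inv (K_star_comp (\<lambda>s. \<integral>y. \<beta>2 s y \<partial>distr \<pi> borel snd) \<beta>0) (real n - 1))"
proof -
  interpret prob_space \<pi> by fact
  interpret hybrid_gibbs \<pi> \<kappa>YX \<kappa>XY H2 \<beta>0 \<beta>2
    by unfold_locales (fact assms)+
  show ?thesis
    using P2_pow_bound[OF assms(15-17)] \<open>n \<ge> 2\<close> by (simp add: \<beta>2'_def[abs_def])
qed

end
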